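(* Let $1\le r<N/2$, $\tau\in\{1,\dots,r+1\}$, let $\mathbf a_0\in\mathbb R^{r+1}$ satisfy $a^{(0)}_\tau=-1$, let $\mathsf S_0\in\mathcal D_r$ satisfy the GLRR($\mathbf a_0$), and let the columns of $\mathbf Z_0\in\mathbb R^{N\times r}$ form a basis of $\mathcal Z(\mathbf a_0)$. Let $S_\tau$ be the local parameterizing mapping of $\mathcal D_r$ near $\mathsf S_0$ (defined in the context). Then, for $(\dot{\mathbf s},\dot{\mathbf a})$ in a sufficiently small neighborhood of $\big((\mathsf S_0)_{\mathcal I(\tau)},(\mathbf a_0)_{\mathcal K(\tau)}\big)$ in $\mathbb R^{2r}$: 1. Put $\mathbf a=H_\tau(\dot{\mathbf a})$, let $\mathbf\Pi_{\mathcal Z(\mathbf a)}$ be the orthogonal projection onto $\mathcal Z(\mathbf a)$, $\mathbf Z=\mathbf\Pi_{\mathcal Z(\mathbf a)}\mathbf Z_0\in\mathbb R^{N\times r}$. Then the $r\times r$ matrix $\mathbf Z_{\mathcal I(\tau),:}$ is invertible and, with $\mathbf G=\mathbf Z\big(\mathbf Z_{\mathcal I(\tau),:}\big)^{-1}$, the mapping $S_\tau$ has the explicit form $$S_\tau(\dot{\mathbf s},\dot{\mathbf a})=\mathbf G\,\dot{\mathbf s}.$$ 2. The inverse of the mapping $S_\tau$ is given as follows: if $\mathsf S=S_\tau(\dot{\mathbf s},\dot{\mathbf a})$, then $$\dot{\mathbf s}=(\mathsf S)_{\mathcal I(\tau)},\qquad \dot{\mathbf a}=\big(-\hat{\mathbf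 a}/\hat a_\tau\big)_{\mathcal K(\tau)},$$ where $\hat{\mathbf a}=(\hat a_1,\dots,\hat a_{r+1})^{\mathrm T}=\big(\mathbf I_{r+1}-\mathbf\Pi_{\mathcal L(\mathsf S)}\big)\mathbf a_0$ (with $\hat a_\tau\ne0$), $\mathcal L(\mathsf S)=\operatorname{colspace}(T_{r+1}(\mathsf S))$, and $\mathbf\Pi_{\mathcal L(\mathsf S)}$ is the orthogonal projection onto $\mathcal L(\mathsf S)$.
   Context: Time series of length $N$ are vectors in $\mathbb R^N$. For $1\le L\le N$, $T_L:\mathbb R^N\to\mathbb R^{L\times(N-L+1)}$ maps $\mathsf S=(s_1,\dots,s_N)^{\mathrm T}$ to the Hankel matrix with $(i,j)$ entry $s_{i+j-1}$. For $r<N/2$, $\mathcal D_r=\{\mathsf S\in\mathbb R^N:\operatorname{rank}T_{r+1}(\mathsf S)=r\}$. For nonzero $\mathbf a\in\mathbb R^{r+1}$, $\mathsf S$ satisfies (is governed by) GLRR($\mathbf a$) if $\mathbf a^{\mathrm T}T_{r+1}(\mathsf S)=\mathbf 0^{\mathrm T}_{N-r}$; $\mathcal Z(\mathbf a)\subset\mathbb R^N$ is the linear space of all series of length $N$ governed by GLRR($\mathbf a$). For $\tau\in\{1,\dots,r+1\}$: $\mathcal I(\tau)=\{1,\dots,N\}\setminus\{\tau,\dots,N-r-1+\tau\}$ and $\mathcal K(\tau)=\{1,\dots,r+1\}\setminus\{\tau\}$ (both have $r$ elements). $\mathbf b_{\mathcal C}$ is the subvector of $\mathbf b$ with indices in $\mathcal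 C$; $\mathbf B_{\mathcal C,:}$ is the submatrix of $\mathbf B$ of rows with indices in $\mathcal C$. $H_\tau:\mathbb R^r\to\mathbb R^{r+1}$ inserts $-1$ at position $\tau$. The local parameterizing mapping $S_\tau$ near $\mathsf S_0$: it is the unique bijection between a neighborhood of $\big((\mathsf S_0)_{\mathcal I(\tau)},(\mathbf a_0)_{\mathcal K(\tau)}\big)\in\mathbb R^{2r}$ and the intersection of a neighborhood of $\mathsf S_0$ with $\mathcal D_r$ such that $\mathsf S=S_\tau(\dot{\mathbf s},\dot{\mathbf a})$ satisfies $(\mathsf S)_{\mathcal I(\tau)}=\dot{\mathbf s}$ and $\mathsf S\in\mathcal D_r$ is governed by GLRR($H_\tau(\dot{\mathbf a})$). *)

theory Defs
  imports
    "HOL-Analysis.L2_Norm"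
    "Jordan_Normal_Form.DL_Rank"
    "Jordan_Normal_Form.DL_Submatrix"
    "Jordan_Normal_Form.Gauss_Jordan_Elimination"
begin

text \<open>
  Series of length \<open>N\<close> are elements of \<open>carrier_vec N\<close>.  All indices are 0-based, as usual for
  these vectors and matrices: entries are numbered \<open>0, \<dots>, N - 1\<close>, and the position \<open>\<tau>\<close>
  ranges over \<open>{0..r}\<close>, so it is the \<open>\<tau>\<close> of the usual 1-based notation minus one.
\<close>

definition hankel :: "nat \<Rightarrow> real vec \<Rightarrow> real mat" where
  "hankel L S = mat L (dim_vec S - L + 1) (\<lambda>(i, j). S $ (i + j))"

definition series_rank :: "nat \<Rightarrow> nat \<Rightarrow> real vec set" where
  "series_rank N r = {S \<in> carrier_vec N. vec_space.rank (r + 1) (hankel (r + 1) S) = r}"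

text \<open>The row-vector identity \<open>a\<^sup>T T = 0\<^sup>T\<close> is written in transposed form.\<close>

definition glrr :: "nat \<Rightarrow> nat \<Rightarrow> real vec \<Rightarrow> real vec \<Rightarrow> bool" where
  "glrr N r a S \<longleftrightarrow> transpose_mat (hankel (r + 1) S) *\<^sub>v a = 0\<^sub>v (N - r)"

definition glrr_space :: "nat \<Rightarrow> nat \<Rightarrow> real vec \<Rightarrow> real vec set" where
  "glrr_space N r a = {S \<in> carrier_vec N. glrr N r a S}"

definition idx_I :: "nat \<Rightarrow> nat \<Rightarrow> nat \<Rightarrow> nat set" where
  "idx_I N r \<tau> = {0..<N} - {\<tau>..<\<tau> + (N - r)}"

definition idx_K :: "nat \<Rightarrow> nat \<Rightarrow> nat set" where
  "idx_K r \<tau> = {0..r} - {\<tau>}"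

text \<open>Vector counterpart of \<^const>\<open>submatrix\<close>.\<close>

definition subvec :: "real vec \<Rightarrow> nat set \<Rightarrow> real vec" where
  "subvec v C = vec (card {i. i < dim_vec v \<and> i \<in> C}) (\<lambda>i. v $ pick C i)"

definition insert_minus_one :: "nat \<Rightarrow> nat \<Rightarrow> real vec \<Rightarrow> real vec" where
  "insert_minus_one r \<tau> a =
     vec (r + 1) (\<lambda>i. if i < \<tau> then a $ i else if i = \<tau> then - 1 else a $ (i - 1))"

definition basis_cols :: "nat \<Rightarrow> real vec set \<Rightarrow> real mat \<Rightarrow> bool" where
  "basis_cols n W B \<longleftrightarrow>
     distinct (cols B) \<and>
     vectorspace.basis class_ring ((module_vec TYPE(real) n)\<lparr>carrier := W\<rparr>) (set (cols B))"

text \<open>The matrix of the orthogonal projection of \<open>\<real>\<^sup>n\<close> onto a linear subspace \<open>W\<close>.\<close>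

definition orth_proj :: "nat \<Rightarrow> real vec set \<Rightarrow> real mat" where
  "orth_proj n W = (THE P. P \<in> carrier_mat n n \<and>
     (\<forall>v \<in> carrier_vec n. P *\<^sub>v v \<in> W \<and> (\<forall>w \<in> W. (v - P *\<^sub>v v) \<bullet> w = 0)))"

text \<open>A neighborhood need not be open; it has to contain a Euclidean ball around the point.\<close>

definition nbhd :: "nat \<Rightarrow> real vec \<Rightarrow> real vec set \<Rightarrow> bool" where
  "nbhd n x U \<longleftrightarrow> U \<subseteq> carrier_vec n \<and>
     (\<exists>\<epsilon>>0. \<forall>y \<in> carrier_vec n. L2_set (\<lambda>i. y $ i - x $ i) {0..<n} < \<epsilon> \<longrightarrow> y \<in> U)"

definition param_center :: "nat \<Rightarrow> nat \<Rightarrow> nat \<Rightarrow> real vec \<Rightarrow> real vec \<Rightarrow> real vec" where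
  "param_center N r \<tau> S0 a0 = subvec S0 (idx_I N r \<tau>) @\<^sub>v subvec a0 (idx_K r \<tau>)"

text \<open>
  \<open>local_param N r \<tau> S0 a0 U P\<close>: the map \<open>P\<close> is a local parameterizing mapping near \<open>S0\<close> with
  domain \<open>U\<close>.  A pair of parameters \<open>(s, a)\<close> is the concatenation \<open>s @\<^sub>v a\<close> in \<open>\<real>\<^bsup>2r\<^esup>\<close>.
  Uniqueness is not demanded: that every \<open>P\<close> with these properties is the same map
  near the center is a consequence of them.
\<close>

definition local_param ::
  "nat \<Rightarrow> nat \<Rightarrow> nat \<Rightarrow> real vec \<Rightarrow> real vec \<Rightarrow> real vec set \<Rightarrow> (real vec \<Rightarrow> real vec) \<Rightarrow> bool" where
  "local_param N r \<tau> S0 a0 U P \<longleftrightarrow>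
     nbhd (2 * r) (param_center N r \<tau> S0 a0) U \<and>
     (\<exists>V. nbhd N S0 V \<and> bij_betw P U (V \<inter> series_rank N r)) \<and>
     (\<forall>s \<in> carrier_vec r. \<forall>a \<in> carrier_vec r. s @\<^sub>v a \<in> U \<longrightarrow>
        subvec (P (s @\<^sub>v a)) (idx_I N r \<tau>) = s \<and>
        glrr N r (insert_minus_one r \<tau> a) (P (s @\<^sub>v a)))"

end

(*
  A series governed by GLRR(a) whose restriction to idx_I is given solves a square Toeplitz system,
  the core of a.  If the core of a0 is nonsingular, then so are the cores of all nearby a, so the
  series governed by a are determined by their values on idx_I; as Z has its columns in the kernel
  of the recurrence, Z times the inverse of its idx_I rows gives the map.  The core of a0 can be
  singular for some GLRRs, but then no local parameterizing mapping exists.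

  Nearness of a to a0 enters only through finitely many inequations det \<noteq> 0 and a \<bullet> a0 \<noteq> 0.
  With Q(a) the banded matrix of the recurrence, a vector of Z(a0) that projects to 0 in Z(a) is
  Q(a) y with Q(a0)^T Q(a) y = 0, so it vanishes as long as det (Q(a0)^T Q(a)) \<noteq> 0.  For the
  inverse, the column space of the trajectory matrix of S is the orthogonal complement of a, so
  projecting a0 onto the complement of the column space gives a nonzero multiple of a.
*)

theory Submission
  imports Defs
begin

section \<open>Linear algebra of real vectors, and orthogonal projections\<close>

lemma scalar_prod_self_eq_0:
  fixes v :: "real vec"
  assumes "v \<in> carrier_vec n" "v \<bullet> v = 0"
  shows "v = 0\<^sub>v n"
  using conjugate_square_eq_0_vec[OF assms(1)] assms(2) by simp

lemma mult_mat_zero_vec: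
  fixes A :: "'a :: semiring_1 mat"
  assumes "A \<in> carrier_mat n m"
  shows "A *\<^sub>v 0\<^sub>v m = 0\<^sub>v n"
  using assms by (auto intro!: eq_vecI)

lemma mult_mat_vec_inject:
  fixes A B :: "'a :: semiring_1 mat"
  assumes A: "A \<in> carrier_mat n m" and B: "B \<in> carrier_mat n m"
    and eq: "\<And>v. v \<in> carrier_vec m \<Longrightarrow> A *\<^sub>v v = B *\<^sub>v v"
  shows "A = B"
proof (rule eq_matI)
  fix i j assume "i < dim_row B" "j < dim_col B"
  with A B have ij: "i < n" "j < m" by auto
  have "col A j = A *\<^sub>v unit_vec m j" 
    using A ij by (auto simp: col_def row_def intro!: eq_vecI)
  moreover have "col B j = B *\<^sub>v unit_vec m j" 
    using B ij by (auto simp: col_def row_def intro!: eq_vecI)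
  ultimately have "col A j $ i = col B j $ i" using eq by simp
  then show "A $$ (i, j) = B $$ (i, j)" using A B ij by simp
qed (use A B in auto)

text \<open>\<open>orth_proj\<close> is a definite description, so uniqueness has to be shown. For
  two candidates, the difference of their values at a vector lies in \<open>W\<close> and is
  orthogonal to \<open>W\<close>, hence to itself.\<close>

lemma orth_proj_eqI:
  assumes W: "W \<subseteq> carrier_vec n"
    and minus: "\<And>v w. v \<in> W \<Longrightarrow> w \<in> W \<Longrightarrow> v - w \<in> W"
    and P: "P \<in> carrier_mat n n"
    and PW: "\<And>v. v \<in> carrier_vec n \<Longrightarrow> P *\<^sub>v v \<in> W"
    and orth: "\<And>v w. v \<in> carrier_vec n \<Longrightarrow> w \<in> W \<Longrightarrow> (v - P *\<^sub>v v) \<bullet> w = 0"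
  shows "orth_proj n W = P"
  unfolding orth_proj_def
proof (rule the_equality)
  fix R :: "real mat"
  assume R: "R \<in> carrier_mat n n \<and>
    (\<forall>v\<in>carrier_vec n. R *\<^sub>v v \<in> W \<and> (\<forall>w\<in>W. (v - R *\<^sub>v v) \<bullet> w = 0))"
  show "R = P"
  proof (rule mult_mat_vec_inject)
    fix v :: "real vec" assume v: "v \<in> carrier_vec n"
    let ?d = "R *\<^sub>v v - P *\<^sub>v v"
    have R': "R *\<^sub>v v \<in> carrier_vec n" and P': "P *\<^sub>v v \<in> carrier_vec n"
      using R P v by auto
    have d: "?d \<in> W" using R PW minus v by blast
    then have dc: "?d \<in> carrier_vec n" using W by auto
    have "x - y = (v - y) - (v - x)" if "x \<in> carrier_vec n" "y \<in> carrier_vec n" for x y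
      using v that by auto
    then have "?d = (v - P *\<^sub>v v) - (v - R *\<^sub>v v)" using R' P' by blast
    then have "?d \<bullet> ?d = (v - P *\<^sub>v v) \<bullet> ?d - (v - R *\<^sub>v v) \<bullet> ?d"
      using minus_scalar_prod_distrib[of "v - P *\<^sub>v v" n "v - R *\<^sub>v v" ?d] v R' P' dc by simp
    also have "\<dots> = 0" using orth[OF v d] R v d by simp
    finally have "?d = 0\<^sub>v n" using scalar_prod_self_eq_0[OF dc] by simp
    then have d0: "?d $ i = 0" if "i < n" for i using that by simp
    show "R *\<^sub>v v = P *\<^sub>v v"
    proof (rule eq_vecI)
      fix i assume "i < dim_vec (P *\<^sub>v v)"
      then have "i < n" using carrier_vecD[OF P'] by linarith
      then show "(R *\<^sub>v v) $ i = (P *\<^sub>v v) $ i"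
        using d0[of i] index_minus_vec(1)[of i "P *\<^sub>v v" "R *\<^sub>v v"] carrier_vecD[OF P'] by linarith
    qed (use R P in auto)
  qed (use R P in auto)
qed (use P PW orth in auto)

lemma det_nonzeroI:
  fixes A :: "'a :: field mat"
  assumes "A \<in> carrier_mat n n"
    and "\<And>v. v \<in> carrier_vec n \<Longrightarrow> A *\<^sub>v v = 0\<^sub>v n \<Longrightarrow> v = 0\<^sub>v n"
  shows "det A \<noteq> 0"
  using assms det_0_iff_vec_prod_zero_field by blast

lemma det_nonzeroD:
  fixes A :: "'a :: field mat"
  assumes "A \<in> carrier_mat n n" "det A \<noteq> 0" "v \<in> carrier_vec n" "A *\<^sub>v v = 0\<^sub>v n"
  shows "v = 0\<^sub>v n"
  using assms det_0_iff_vec_prod_zero_field by blast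

lemma det_nonzero_inverse:
  fixes A :: "'a :: field mat"
  assumes A: "A \<in> carrier_mat n n" and "det A \<noteq> 0"
  obtains B where "mat_inverse A = Some B" "B \<in> carrier_mat n n" "A * B = 1\<^sub>m n" "B * A = 1\<^sub>m n"
  using mat_inverse(1)[OF A, where b = "()"] mat_inverse(2)[OF A] det_non_zero_imp_unit[OF assms, where b = "()"]
  by (metis option.exhaust)

text \<open>The projection is I - Q (Q^T Q)^(-1) Q^T. What it removes from a vector lies in the
  range of \<open>Q\<close>, and that range is orthogonal to the kernel of Q^T. It is applied to the
  banded matrix of a recurrence and to a single column.\<close>

lemma orth_proj_kernel:
  fixes Q :: "real mat"
  assumes Q: "Q \<in> carrier_mat n m" and "det (transpose_mat Q * Q) \<noteq> 0"
  defines "P \<equiv> orth_proj n {v \<in> carrier_vec n. transpose_mat Q *\<^sub>v v = 0\<^sub>v m}"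
  shows "P \<in> carrier_mat n n"
    and "v \<in> carrier_vec n \<Longrightarrow> transpose_mat Q *\<^sub>v (P *\<^sub>v v) = 0\<^sub>v m"
    and "v \<in> carrier_vec n \<Longrightarrow> \<exists>y \<in> carrier_vec m. v - P *\<^sub>v v = Q *\<^sub>v y"
proof -
  let ?W = "{v \<in> carrier_vec n. transpose_mat Q *\<^sub>v v = 0\<^sub>v m}"
  have QT: "transpose_mat Q \<in> carrier_mat m n" using Q by simp
  obtain B where B: "B \<in> carrier_mat m m" "(transpose_mat Q * Q) * B = 1\<^sub>m m"
    using det_nonzero_inverse[of "transpose_mat Q * Q" m] assms(2) Q by auto
  define R where "R = 1\<^sub>m n - Q * (B * transpose_mat Q)"
  have R: "R \<in> carrier_mat n n" using Q B by (auto simp: R_def)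
  let ?y = "\<lambda>v. B *\<^sub>v (transpose_mat Q *\<^sub>v v)"
  have Rv: "R *\<^sub>v v = v - Q *\<^sub>v ?y v" if "v \<in> carrier_vec n" for v
  proof -
    have "R *\<^sub>v v = 1\<^sub>m n *\<^sub>v v - (Q * (B * transpose_mat Q)) *\<^sub>v v"
      unfolding R_def using Q B that by (intro minus_mult_distrib_mat_vec[where nr=n and nc = n]) auto
    then show ?thesis using that Q B QT
      by (simp add: assoc_mult_mat_vec[of Q n m _ n] assoc_mult_mat_vec[of B m m _ n])
  qed
  have diff: "v - R *\<^sub>v v = Q *\<^sub>v ?y v" if "v \<in> carrier_vec n" for v
  proof -
    have "Q *\<^sub>v ?y v \<in> carrier_vec n" using Q B that by simp
    then show ?thesis using that by (auto simp: Rv intro!: eq_vecI)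
  qed
  have ker: "transpose_mat Q *\<^sub>v (R *\<^sub>v v) = 0\<^sub>v m" if v: "v \<in> carrier_vec n" for v
  proof -
    have q: "transpose_mat Q *\<^sub>v v \<in> carrier_vec m" and yc: "?y v \<in> carrier_vec m" using QT B v by auto
    have "transpose_mat Q *\<^sub>v (R *\<^sub>v v)
        = transpose_mat Q *\<^sub>v v - transpose_mat Q *\<^sub>v (Q *\<^sub>v ?y v)"
      using QT Q B v by (simp add: Rv mult_minus_distrib_mat_vec[of _ m n])
    also have "transpose_mat Q *\<^sub>v (Q *\<^sub>v ?y v) = (transpose_mat Q * Q) *\<^sub>v ?y v"
      using assoc_mult_mat_vec[OF QT Q yc] by simp
    also have "\<dots> = ((transpose_mat Q * Q) * B) *\<^sub>v (transpose_mat Q *\<^sub>v v)"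
      using assoc_mult_mat_vec[of "transpose_mat Q * Q" m m B m] QT Q B q by simp
    also have "\<dots> = transpose_mat Q *\<^sub>v v" unfolding B(2) using q by simp
    finally show ?thesis using q by simp
  qed
  have "P = R" unfolding P_def
  proof (rule orth_proj_eqI)
    fix v w :: "real vec" assume v: "v \<in> carrier_vec n" and w: "w \<in> ?W"
    have "(v - R *\<^sub>v v) \<bullet> w = (Q *\<^sub>v ?y v) \<bullet> w" by (simp add: diff v)
    also have "\<dots> = w \<bullet> (Q *\<^sub>v ?y v)"
      using w Q B QT v by (intro comm_scalar_prod[of _ n]) auto
    also have "\<dots> = (transpose_mat Q *\<^sub>v w) \<bullet> ?y v"
      using w B QT v by (intro transpose_vec_mult_scalar[symmetric, OF Q]) auto
    also have "\<dots> = 0" using w B QT v by simp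
    finally show "(v - R *\<^sub>v v) \<bullet> w = 0" .
  next
    fix v w assume "v \<in> ?W" "w \<in> ?W"
    then show "v - w \<in> ?W" using QT by (auto simp: mult_minus_distrib_mat_vec[of _ m n])
  qed (use R ker in auto)
  then show "P \<in> carrier_mat n n"
    and "v \<in> carrier_vec n \<Longrightarrow> transpose_mat Q *\<^sub>v (P *\<^sub>v v) = 0\<^sub>v m"
    and "v \<in> carrier_vec n \<Longrightarrow> \<exists>y \<in> carrier_vec m. v - P *\<^sub>v v = Q *\<^sub>v y"
    using R ker diff B QT by auto
qed

section \<open>Matrices of corank one\<close>

context vec_space
begin

text \<open>Orthogonality to \<open>S\<close> extends to its span, so \<open>a\<close> in the span
  would be orthogonal to itself.\<close>

lemma lin_indpt_insert_orthogonal: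
  assumes S: "S \<subseteq> carrier_vec n" "lin_indpt S"
    and a: "a \<in> carrier_vec n" "a \<bullet> a \<noteq> 0" and orth: "\<And>s. s \<in> S \<Longrightarrow> a \<bullet> s = 0"
  shows "lin_indpt (insert a S)" "a \<notin> S"
proof -
  have "a \<in> orthogonal_complement S" using a orth by (auto simp: orthogonal_complement_def)
  then have "a \<in> orthogonal_complement (span S)" using in_orthogonal_complement_span[OF S(1)] by simp
  then have *: "a \<notin> span S" using a(2) by (auto simp: orthogonal_complement_def)
  then show "a \<notin> S" using S(1) in_own_span by auto
  then show "lin_indpt (insert a S)"
    using lin_dep_iff_in_span[of S a] S a * by simp
qed

lemma maximal_lin_indpt_span:
  assumes S: "S \<subseteq> carrier_vec n" and U: "maximal U (\<lambda>T. T \<subseteq> S \<and> lin_indpt T)"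
  shows "S \<subseteq> span U"
proof
  fix s assume s: "s \<in> S"
  from U have U': "U \<subseteq> S" "lin_indpt U" unfolding maximal_def by auto
  show "s \<in> span U"
  proof (rule ccontr)
    assume ns: "s \<notin> span U"
    have sU: "s \<notin> U" using ns U' S in_own_span by blast
    then have "lin_indpt (insert s U)" using lin_dep_iff_in_span[of U s] U' S s ns by auto
    then show False using U s U' sU unfolding maximal_def by blast
  qed
qed

end

text \<open>A maximal independent set of columns has as many elements as the rank. The vector
  \<open>a\<close> is orthogonal to every column, so adding it keeps independence. Corank one then
  means that \<open>T\<close> is a basis of the whole space.\<close>

lemma exists_basis_rank_Suc:
  fixes A :: "real mat"
  assumes A: "A \<in> carrier_mat n m" and a: "a \<in> carrier_vec n" "a \<noteq> 0\<^sub>v n"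
    and ker: "transpose_mat A *\<^sub>v a = 0\<^sub>v m"
  obtains T where "finite T" "T \<subseteq> carrier_vec n"
    "\<not> module.lin_dep class_ring (module_vec TYPE(real) n) T"
    "card T = vec_space.rank n A + 1" "T \<subseteq> insert a (set (cols A))"
    "insert a (set (cols A)) \<subseteq> LinearCombinations.module.span class_ring (module_vec TYPE(real) n) T"
proof -
  interpret vec_space "TYPE(real)" n .
  have cA: "set (cols A) \<subseteq> carrier_vec n" using A cols_dim by blast
  have "\<exists>S. finite S \<and> maximal S (\<lambda>T. T \<subseteq> set (cols A) \<and> lin_indpt T)"
  proof (rule maximal_exists[where B = "{}" and N = "card (set (cols A))"])
    show "{} \<subseteq> set (cols A) \<and> lin_indpt {}"
      by (simp add: lin_dep_def)
  qed (simp add: card_mono finite_subset[of _ "set (cols A)"])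
  then obtain S where S: "finite S" "maximal S (\<lambda>T. T \<subseteq> set (cols A) \<and> lin_indpt T)" by blast
  then have S': "S \<subseteq> set (cols A)" "lin_indpt S" unfolding maximal_def by auto
  have aa: "a \<bullet> a \<noteq> 0" using a scalar_prod_self_eq_0 by blast
  have orth: "a \<bullet> s = 0" if "s \<in> set (cols A)" for s
  proof -
    from that A obtain j where j: "j < m" "s = col A j" by (auto simp: cols_def)
    have "(transpose_mat A *\<^sub>v a) $ j = 0" using ker j by simp
    then have "col A j \<bullet> a = 0" using A j by simp
    then show ?thesis using comm_scalar_prod[of a n s] a A j by auto
  qed
  have li: "lin_indpt (insert a S)" "a \<notin> S"
    using lin_indpt_insert_orthogonal[of S a] S' cA a aa orth by auto
  have "set (cols A) \<subseteq> span (insert a S)"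
    using maximal_lin_indpt_span[OF cA S(2)] span_is_monotone[of S "insert a S"] by auto
  moreover have "a \<in> span (insert a S)" using in_own_span[of "insert a S"] a S' cA by auto
  ultimately show ?thesis
    using S S' li rank_card_indpt[OF A S(2)] cA a
    by (intro that[of "insert a S"]) auto
qed

lemma outer_prod_mult_vec:
  fixes a v :: "real vec"
  assumes "a \<in> carrier_vec n" "v \<in> carrier_vec n"
  shows "mat n n (\<lambda>(i, j). a $ i * a $ j) *\<^sub>v v = (a \<bullet> v) \<cdot>\<^sub>v a"
  using assms by (auto intro!: eq_vecI simp: scalar_prod_def sum_distrib_right sum_distrib_left ac_simps)

text \<open>For \<open>a\<close> in the left kernel of \<open>A\<close>, the determinant of this matrix turns the condition that
  \<open>A\<close> has corank one into one that is open in the entries of \<open>A\<close>.\<close>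

definition bordered_gram :: "nat \<Rightarrow> real mat \<Rightarrow> real vec \<Rightarrow> real mat" where
  "bordered_gram n A a = A * transpose_mat A + mat n n (\<lambda>(i, j). a $ i * a $ j)"

lemma bordered_gram_carrier [simp]:
  "A \<in> carrier_mat n m \<Longrightarrow> bordered_gram n A a \<in> carrier_mat n n"
  by (simp add: bordered_gram_def)

lemma bordered_gram_mult_vec:
  assumes A: "A \<in> carrier_mat n m" and a: "a \<in> carrier_vec n" and v: "v \<in> carrier_vec n"
  shows "bordered_gram n A a *\<^sub>v v = A *\<^sub>v (transpose_mat A *\<^sub>v v) + (a \<bullet> v) \<cdot>\<^sub>v a"
  using assms outer_prod_mult_vec[OF a v]
  by (simp add: bordered_gram_def add_mult_distrib_mat_vec[of _ n n] assoc_mult_mat_vec[of A n m _ n])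

text \<open>The range of A A^T + a a^T lies in the span of the columns and \<open>a\<close>, that
  is, of \<open>T\<close>; if it is everything, \<open>T\<close> has \<open>n\<close> elements.
  Conversely, the quadratic form of this matrix at \<open>w\<close> is |A^T w|^2 + (a . w)^2. It
  vanishes only if \<open>w\<close> is orthogonal to \<open>T\<close>, and so only at 0 once
  \<open>T\<close> is a basis.\<close>

lemma det_bordered_gram_iff:
  assumes A: "A \<in> carrier_mat n m" and a: "a \<in> carrier_vec n" "a \<noteq> 0\<^sub>v n"
    and ker: "transpose_mat A *\<^sub>v a = 0\<^sub>v m"
  shows "det (bordered_gram n A a) \<noteq> 0 \<longleftrightarrow> vec_space.rank n A + 1 = n"
proof -
  interpret vec_space "TYPE(real)" n .
  have cA: "set (cols A) \<subseteq> carrier_vec n" using A cols_dim by blast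
  obtain T where T: "finite T" "T \<subseteq> carrier_vec n" "lin_indpt T" "card T = rank A + 1"
    "T \<subseteq> insert a (set (cols A))" "insert a (set (cols A)) \<subseteq> span T"
    using exists_basis_rank_Suc[OF A a ker] by blast
  show ?thesis
  proof
    assume d: "det (bordered_gram n A a) \<noteq> 0"
    have "span T = carrier_vec n"
    proof
      show "span T \<subseteq> carrier_vec n" using T span_is_subset2 by simp
      show "carrier_vec n \<subseteq> span T"
      proof
        fix v :: "real vec" assume v: "v \<in> carrier_vec n"
        obtain B where B: "B \<in> carrier_mat n n" "bordered_gram n A a * B = 1\<^sub>m n"
          using det_nonzero_inverse[OF bordered_gram_carrier[OF A] d] by metis
        let ?u = "B *\<^sub>v v"
        have u: "?u \<in> carrier_vec n" using B v by simp
        have "v = bordered_gram n A a *\<^sub>v ?u"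
          using B v assoc_mult_mat_vec[of "bordered_gram n A a" n n B n v] A by simp
        then have eq: "v = A *\<^sub>v (transpose_mat A *\<^sub>v ?u) + (a \<bullet> ?u) \<cdot>\<^sub>v a"
          using bordered_gram_mult_vec[OF A a(1) u] by simp
        have "A *\<^sub>v (transpose_mat A *\<^sub>v ?u) \<in> col_space A"
          unfolding col_space_eq[OF A] using A u by auto
        moreover have "col_space A \<subseteq> span T"
          unfolding col_space_def using T span_subsetI[of T "set (cols A)"] by simp
        moreover have "(a \<bullet> ?u) \<cdot>\<^sub>v a \<in> span T" using T smult_in_span[of T a] by auto
        ultimately have "A *\<^sub>v (transpose_mat A *\<^sub>v ?u) + (a \<bullet> ?u) \<cdot>\<^sub>v a \<in> span T"
          using T span_add1[of T] by blast
        then show "v \<in> span T" unfolding eq[symmetric] .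
      qed
    qed
    then have "n \<le> card T" using gen_ge_dim[of T] T dim_is_n by simp
    moreover have "card T \<le> n" using li_le_dim(2)[of T] T dim_is_n by simp
    ultimately show "rank A + 1 = n" using T by simp
  next
    assume r: "rank A + 1 = n"
    then have "basis T" using dim_li_is_basis[of T] T dim_is_n by simp
    then have sp: "span T = carrier_vec n" by (simp add: basis_def)
    show "det (bordered_gram n A a) \<noteq> 0"
    proof (rule det_nonzeroI)
      fix w :: "real vec" assume w: "w \<in> carrier_vec n" and 0: "bordered_gram n A a *\<^sub>v w = 0\<^sub>v n"
      have Aw: "transpose_mat A *\<^sub>v w \<in> carrier_vec m" using A w by simp
      \<comment> \<open>Pairing the kernel equation with \<open>w\<close> gives a sum of two squares
        equal to zero.\<close>
      have "w \<bullet> (A *\<^sub>v (transpose_mat A *\<^sub>v w)) + (a \<bullet> w) * (w \<bullet> a) = w \<bullet> 0\<^sub>v n"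
        using bordered_gram_mult_vec[OF A a(1) w] 0 A w a
          scalar_prod_add_distrib[of w n "A *\<^sub>v (transpose_mat A *\<^sub>v w)" "(a \<bullet> w) \<cdot>\<^sub>v a"] by simp
      then have "(transpose_mat A *\<^sub>v w) \<bullet> (transpose_mat A *\<^sub>v w) + (a \<bullet> w) * (a \<bullet> w) = 0"
        using transpose_vec_mult_scalar[OF A Aw w] comm_scalar_prod[OF w a(1)] w by simp
      moreover have "(transpose_mat A *\<^sub>v w) \<bullet> (transpose_mat A *\<^sub>v w) \<ge> 0"
        by (auto simp: scalar_prod_def intro!: sum_nonneg)
      ultimately have z: "(transpose_mat A *\<^sub>v w) \<bullet> (transpose_mat A *\<^sub>v w) = 0" "a \<bullet> w = 0"
        by (auto simp: add_nonneg_eq_0_iff)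
      then have Aw0: "transpose_mat A *\<^sub>v w = 0\<^sub>v m" using scalar_prod_self_eq_0[OF Aw] by simp
      have "w \<bullet> c = 0" if "c \<in> insert a (set (cols A))" for c
      proof -
        have "w \<bullet> col A j = 0" if j: "j < m" for j
        proof -
          have "(transpose_mat A *\<^sub>v w) $ j = 0" using Aw0 j by simp
          then show ?thesis using A j w comm_scalar_prod[of w n "col A j"] by simp
        qed
        then show ?thesis using that A z comm_scalar_prod[OF w a(1)] by (auto simp: cols_def)
      qed
      then have "w \<in> orthogonal_complement T" using w T(5) by (auto simp: orthogonal_complement_def)
      then have "w \<in> orthogonal_complement (span T)" using in_orthogonal_complement_span[OF T(2)] by simp
      then have "w \<bullet> w = 0" using sp w by (auto simp: orthogonal_complement_def)
      then show "w = 0\<^sub>v n" using scalar_prod_self_eq_0[OF w] by simp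
    qed (use A in simp)
  qed
qed

text \<open>Columns are orthogonal to \<open>a\<close> by \<open>ker\<close>. For the other
  inclusion, \<open>v\<close> is written as the bordered Gram matrix applied to some u. Pairing with
  \<open>a\<close> shows a . u = 0, which leaves v = A (A^T u).\<close>

lemma col_space_eq_orthogonal:
  fixes A :: "real mat"
  assumes A: "A \<in> carrier_mat n m" and a: "a \<in> carrier_vec n" "a \<noteq> 0\<^sub>v n"
    and ker: "transpose_mat A *\<^sub>v a = 0\<^sub>v m" and rk: "vec_space.rank n A + 1 = n"
  shows "vec_space.col_space n A = {v \<in> carrier_vec n. a \<bullet> v = 0}"
proof -
  interpret vec_space "TYPE(real)" n .
  have orth: "a \<bullet> (A *\<^sub>v u) = 0" if "u \<in> carrier_vec m" for u
    using transpose_vec_mult_scalar[OF A that a(1)] ker that by simp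
  obtain B where B: "B \<in> carrier_mat n n" "bordered_gram n A a * B = 1\<^sub>m n"
    using det_nonzero_inverse[OF bordered_gram_carrier[OF A]] det_bordered_gram_iff[OF A a ker] rk by metis
  show ?thesis
  proof (intro equalityI subsetI)
    fix v assume "v \<in> col_space A"
    then show "v \<in> {v \<in> carrier_vec n. a \<bullet> v = 0}" using orth A by (auto simp: col_space_eq[OF A])
  next
    fix v :: "real vec" assume v: "v \<in> {v \<in> carrier_vec n. a \<bullet> v = 0}"
    let ?u = "B *\<^sub>v v"
    have u: "?u \<in> carrier_vec n" using B v by simp
    have "v = bordered_gram n A a *\<^sub>v ?u"
      using B v assoc_mult_mat_vec[of "bordered_gram n A a" n n B n v] A by simp
    then have eq: "v = A *\<^sub>v (transpose_mat A *\<^sub>v ?u) + (a \<bullet> ?u) \<cdot>\<^sub>v a"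
      using bordered_gram_mult_vec[OF A a(1) u] by simp
    have "0 = a \<bullet> (A *\<^sub>v (transpose_mat A *\<^sub>v ?u) + (a \<bullet> ?u) \<cdot>\<^sub>v a)" using v eq by simp
    also have "\<dots> = (a \<bullet> ?u) * (a \<bullet> a)"
      using orth[of "transpose_mat A *\<^sub>v ?u"] A a u by (simp add: scalar_prod_add_distrib[of _ n])
    finally have "a \<bullet> ?u = 0" using a scalar_prod_self_eq_0 by auto
    then have "v = A *\<^sub>v (transpose_mat A *\<^sub>v ?u)" using eq A a u by (auto intro!: eq_vecI)
    moreover have "transpose_mat A *\<^sub>v ?u \<in> carrier_vec m" using A u by simp
    ultimately have "\<exists>x\<in>carrier_vec (dim_col A). A *\<^sub>v x = v" using A by (metis carrier_matD(2))
    then show "v \<in> col_space A" using A v by (simp add: col_space_eq[OF A])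
  qed
qed

section \<open>Neighborhoods and limits in R^n\<close>

text \<open>The balls of \<open>nbhd\<close> as a filter, so that open conditions on parameters
  follow from limits and finitely many of them can be intersected. The balls are cut down to
  \<open>carrier_vec n\<close>, so dimensions are eventually correct.\<close>

definition vec_nhds :: "nat \<Rightarrow> real vec \<Rightarrow> real vec filter" where
  "vec_nhds n x =
     (INF \<epsilon>\<in>{0<..}. principal {y \<in> carrier_vec n. L2_set (\<lambda>i. y $ i - x $ i) {0..<n} < \<epsilon>})"

lemma eventually_vec_nhds:
  "eventually P (vec_nhds n x) \<longleftrightarrow>
     (\<exists>\<epsilon>>0. \<forall>y \<in> carrier_vec n. L2_set (\<lambda>i. y $ i - x $ i) {0..<n} < \<epsilon> \<longrightarrow> P y)"
  unfolding vec_nhds_def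
proof (subst eventually_INF_base)
  fix a b :: real assume "a \<in> {0<..}" "b \<in> {0<..}"
  then show "\<exists>e\<in>{0<..}. principal {y \<in> carrier_vec n. L2_set (\<lambda>i. y $ i - x $ i) {0..<n} < e}
    \<le> inf (principal {y \<in> carrier_vec n. L2_set (\<lambda>i. y $ i - x $ i) {0..<n} < a})
        (principal {y \<in> carrier_vec n. L2_set (\<lambda>i. y $ i - x $ i) {0..<n} < b})"
    by (intro bexI[of _ "min a b"]) auto
qed (auto simp: eventually_principal intro: exI[of _ 1])

lemma nbhd_iff_eventually:
  "nbhd n x U \<longleftrightarrow> U \<subseteq> carrier_vec n \<and> eventually (\<lambda>y. y \<in> U) (vec_nhds n x)"
  by (simp add: nbhd_def eventually_vec_nhds)

lemma eventually_vec_nhds_self: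
  "eventually P (vec_nhds n x) \<Longrightarrow> x \<in> carrier_vec n \<Longrightarrow> P x"
  by (auto simp: eventually_vec_nhds L2_set_def)

lemma tendsto_vec_index:
  assumes "i < n"
  shows "((\<lambda>y. y $ i) \<longlongrightarrow> x $ i) (vec_nhds n x)"
proof (rule tendstoI)
  fix e :: real assume e: "e > 0"
  have "\<bar>y $ i - x $ i\<bar> \<le> L2_set (\<lambda>i. y $ i - x $ i) {0..<n}" for y
    using member_le_L2_set[of "{0..<n}" i "\<lambda>i. \<bar>y $ i - x $ i\<bar>"] assms
    by (simp add: L2_set_def)
  then show "\<forall>\<^sub>F y in vec_nhds n x. dist (y $ i) (x $ i) < e"
    unfolding eventually_vec_nhds dist_real_def using e le_less_trans by blast
qed

text \<open>The distance from \<open>x\<close> to the point with parameter t is |t| times the norm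
  of \<open>d\<close>, which tends to 0.\<close>

lemma eventually_vec_nhds_line:
  assumes ev: "eventually P (vec_nhds n x)" and x: "x \<in> carrier_vec n" and d: "d \<in> carrier_vec n"
  shows "\<forall>\<^sub>F t in at (0::real). P (x + t \<cdot>\<^sub>v d)"
proof -
  obtain e where e: "e > 0"
    "\<And>y. y \<in> carrier_vec n \<Longrightarrow> L2_set (\<lambda>i. y $ i - x $ i) {0..<n} < e \<Longrightarrow> P y"
    using ev by (auto simp: eventually_vec_nhds)
  have L: "L2_set (\<lambda>i. (x + t \<cdot>\<^sub>v d) $ i - x $ i) {0..<n} = \<bar>t\<bar> * L2_set (($) d) {0..<n}" for t
  proof -
    have "L2_set (\<lambda>i. (x + t \<cdot>\<^sub>v d) $ i - x $ i) {0..<n} = L2_set (\<lambda>i. \<bar>t\<bar> * d $ i) {0..<n}"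
      unfolding L2_set_def using x d by (intro arg_cong[of _ _ sqrt] sum.cong) (auto simp: power_mult_distrib)
    then show ?thesis by (simp add: L2_set_right_distrib)
  qed
  have "((\<lambda>t::real. \<bar>t\<bar> * L2_set (($) d) {0..<n}) \<longlongrightarrow> 0) (at 0)"
    by (auto intro!: tendsto_eq_intros)
  then have "\<forall>\<^sub>F t in at 0. \<bar>t\<bar> * L2_set (($) d) {0..<n} < e"
    using e(1) by (rule order_tendstoD(2))
  then show ?thesis
    by eventually_elim (use e(2) L x d in auto)
qed

text \<open>By the Leibniz formula the determinant is a polynomial in the entries.\<close>

lemma tendsto_det:
  fixes A :: "'b \<Rightarrow> real mat"
  assumes "\<And>x. A x \<in> carrier_mat n n" "B \<in> carrier_mat n n"
    and "\<And>i j. i < n \<Longrightarrow> j < n \<Longrightarrow> ((\<lambda>x. A x $$ (i, j)) \<longlongrightarrow> B $$ (i, j)) F"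
  shows "((\<lambda>x. det (A x)) \<longlongrightarrow> det B) F"
proof -
  have "p i < n" if "p permutes {0..<n}" "i < n" for p i
    using permutes_in_image[OF that(1), of i] that(2) by simp
  then show ?thesis
    unfolding det_def'[OF assms(1)] det_def'[OF assms(2)]
    by (auto intro!: tendsto_sum tendsto_mult tendsto_prod assms(3))
qed

section \<open>Subvectors and the index sets of the two parameters\<close>

lemma subvec_eq_iff:
  assumes "v \<in> carrier_vec n" "w \<in> carrier_vec n" and C: "C \<subseteq> {0..<n}"
  shows "subvec v C = subvec w C \<longleftrightarrow> (\<forall>i\<in>C. v $ i = w $ i)"
proof -
  have fin: "finite C" using C finite_subset by auto
  have C': "{i. i < n \<and> i \<in> C} = C" using C by auto
  have sub: "dim_vec (subvec u C) = card C" "\<And>k. k < card C \<Longrightarrow> subvec u C $ k = u $ pick C k"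
    if "u \<in> carrier_vec n" for u
    using that C' by (auto simp: subvec_def)
  show ?thesis
  proof
    assume eq: "subvec v C = subvec w C"
    show "\<forall>i\<in>C. v $ i = w $ i"
    proof
      fix i assume i: "i \<in> C"
      \<comment> \<open>The number of smaller elements of \<open>C\<close> is the position at which
        \<open>pick\<close> finds \<open>i\<close>.\<close>
      let ?k = "card {a \<in> C. a < i}"
      have "?k < card C" using i fin by (intro psubset_card_mono) auto
      then show "v $ i = w $ i" using sub(2)[of v ?k] sub(2)[of w ?k] eq assms pick_card_in_set[OF i] by simp
    qed
  next
    assume "\<forall>i\<in>C. v $ i = w $ i"
    then show "subvec v C = subvec w C"
      using sub assms pick_in_set_le by (intro eq_vecI) auto
  qed
qed

lemma submatrix_mult_vec:
  fixes A :: "real mat"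
  assumes A: "A \<in> carrier_mat n m" and x: "x \<in> carrier_vec m"
  shows "submatrix A C UNIV *\<^sub>v x = subvec (A *\<^sub>v x) C"
proof (rule eq_vecI)
  fix i assume "i < dim_vec (subvec (A *\<^sub>v x) C)"
  then have i: "i < card {i. i < n \<and> i \<in> C}" using A by (simp add: subvec_def)
  then show "(submatrix A C UNIV *\<^sub>v x) $ i = subvec (A *\<^sub>v x) C $ i"
    using A x pick_le[OF i]
    by (simp add: submatrix_def subvec_def scalar_prod_def pick_UNIV)
qed (use A in \<open>simp add: submatrix_def subvec_def\<close>)

lemma idx_I_subset: "idx_I N r \<tau> \<subseteq> {0..<N}"
  by (auto simp: idx_I_def)

text \<open>Because \<tau> is at most \<open>r\<close>, the removed block of \<open>N - r\<close>
  consecutive positions fits into \<open>{0..<N}\<close>.\<close>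

lemma card_idx_I:
  assumes "\<tau> \<le> r" "r \<le> N" shows "card (idx_I N r \<tau>) = r"
  using assms unfolding idx_I_def by (subst card_Diff_subset) auto

lemma subvec_idx_I_carrier:
  assumes "S \<in> carrier_vec N" "\<tau> \<le> r" "r \<le> N"
  shows "subvec S (idx_I N r \<tau>) \<in> carrier_vec r"
proof -
  have I: "{i. i < N \<and> i \<in> idx_I N r \<tau>} = idx_I N r \<tau>" using idx_I_subset[of N r \<tau>] by auto
  show ?thesis
    unfolding subvec_def carrier_vecD[OF assms(1)] I card_idx_I[OF assms(2,3)] by simp
qed

lemma card_idx_K: "\<tau> \<le> r \<Longrightarrow> card (idx_K r \<tau>) = r"
  by (simp add: idx_K_def)

lemma pick_idx_K:
  assumes "j < r" "\<tau> \<le> r"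
  shows "pick (idx_K r \<tau>) j = (if j < \<tau> then j else Suc j)"
proof -
  let ?i = "if j < \<tau> then j else Suc j"
  have "{a \<in> idx_K r \<tau>. a < ?i} = (if j < \<tau> then {0..<j} else {0..<Suc j} - {\<tau>})"
    using assms by (auto simp: idx_K_def)
  then have "card {a \<in> idx_K r \<tau>. a < ?i} = j" by simp
  moreover have "?i \<in> idx_K r \<tau>" using assms by (auto simp: idx_K_def)
  ultimately show ?thesis using pick_card_in_set[of ?i "idx_K r \<tau>"] by simp
qed

lemma subvec_idx_K:
  assumes "a \<in> carrier_vec (r + 1)" "\<tau> \<le> r"
  shows "subvec a (idx_K r \<tau>) = vec r (\<lambda>j. a $ (if j < \<tau> then j else Suc j))"
proof -
  have K: "{i. i < r + 1 \<and> i \<in> idx_K r \<tau>} = idx_K r \<tau>" by (auto simp: idx_K_def)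
  have "subvec a (idx_K r \<tau>) = vec r (\<lambda>j. a $ pick (idx_K r \<tau>) j)"
    unfolding subvec_def carrier_vecD[OF assms(1)] K card_idx_K[OF assms(2)] ..
  then show ?thesis using assms(2) by (auto simp: pick_idx_K intro!: eq_vecI)
qed

lemma insert_minus_one_carrier: "insert_minus_one r \<tau> a \<in> carrier_vec (r + 1)"
  by (simp add: insert_minus_one_def)

lemma insert_minus_one_index: "\<tau> \<le> r \<Longrightarrow> insert_minus_one r \<tau> a $ \<tau> = - 1"
  by (simp add: insert_minus_one_def)

lemma subvec_insert_minus_one:
  assumes "a \<in> carrier_vec r" "\<tau> \<le> r"
  shows "subvec (insert_minus_one r \<tau> a) (idx_K r \<tau>) = a"
  using assms by (subst subvec_idx_K) (auto simp: insert_minus_one_def)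

lemma insert_minus_one_subvec:
  assumes "a \<in> carrier_vec (r + 1)" "\<tau> \<le> r" "a $ \<tau> = - 1"
  shows "insert_minus_one r \<tau> (subvec a (idx_K r \<tau>)) = a"
  using assms by (intro eq_vecI) (auto simp: subvec_idx_K insert_minus_one_def)

section \<open>The banded matrix of a recurrence and its Toeplitz core\<close>

text \<open>The transpose of this banded matrix maps a series to the values of the recurrence along it,
  so that \<open>glrr_space N r a\<close> is the kernel of the transpose.\<close>

definition glrr_mat :: "nat \<Rightarrow> nat \<Rightarrow> real vec \<Rightarrow> real mat" where
  "glrr_mat N r a = mat N (N - r) (\<lambda>(i, j). if j \<le> i \<and> i \<le> j + r then a $ (i - j) else 0)"

lemma glrr_mat_carrier [simp]: "glrr_mat N r a \<in> carrier_mat N (N - r)"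
  by (simp add: glrr_mat_def)

lemma dim_glrr_mat [simp]: "dim_row (glrr_mat N r a) = N" "dim_col (glrr_mat N r a) = N - r"
  by (simp_all add: glrr_mat_def)

lemma hankel_eq:
  assumes "S \<in> carrier_vec N" "r < N"
  shows "hankel (r + 1) S = mat (r + 1) (N - r) (\<lambda>(i, j). S $ (i + j))"
proof -
  \<comment> \<open>Subtraction on naturals truncates; the equation relies on
    \<open>r < N\<close>.\<close>
  have "dim_vec S - (r + 1) + 1 = N - r" using assms by auto
  then show ?thesis unfolding hankel_def by (simp only:)
qed

lemma hankel_carrier: "S \<in> carrier_vec N \<Longrightarrow> r < N \<Longrightarrow> hankel (r + 1) S \<in> carrier_mat (r + 1) (N - r)"
  by (auto simp: hankel_def)

text \<open>The recurrence is bilinear in the coefficients and the series. The Hankel matrix of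
  \<open>S\<close> acting on \<open>a\<close> and the banded matrix of \<open>a\<close> acting on
  \<open>S\<close> give the same sums.\<close>

lemma glrr_iff:
  assumes S: "S \<in> carrier_vec N" and a: "a \<in> carrier_vec (r + 1)" and r: "r < N"
  shows "glrr N r a S \<longleftrightarrow> transpose_mat (glrr_mat N r a) *\<^sub>v S = 0\<^sub>v (N - r)"
proof -
  have "transpose_mat (hankel (r + 1) S) *\<^sub>v a = transpose_mat (glrr_mat N r a) *\<^sub>v S"
  proof (rule eq_vecI)
    fix j assume "j < dim_vec (transpose_mat (glrr_mat N r a) *\<^sub>v S)"
    then have j: "j < N - r" by (simp add: glrr_mat_def)
    have "(transpose_mat (glrr_mat N r a) *\<^sub>v S) $ j
        = (\<Sum>i = 0..<N. (if j \<le> i \<and> i \<le> j + r then a $ (i - j) else 0) * S $ i)"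
      using j S by (simp add: glrr_mat_def scalar_prod_def)
    \<comment> \<open>Only the band of column \<open>j\<close> contributes; it fits into the range
      of summation since \<open>j < N - r\<close>.\<close>
    also have "\<dots> = (\<Sum>i = j..<j + (r + 1). a $ (i - j) * S $ i)"
      using j by (intro sum.mono_neutral_cong_right) auto
    also have "\<dots> = (\<Sum>i = 0..<r + 1. a $ i * S $ (i + j))"
      by (subst sum.atLeastLessThan_shift_0) (simp add: add.commute)
    also have "\<dots> = (transpose_mat (hankel (r + 1) S) *\<^sub>v a) $ j"
      using j S a r by (simp add: hankel_def scalar_prod_def mult.commute)
    finally show "(transpose_mat (hankel (r + 1) S) *\<^sub>v a) $ j = (transpose_mat (glrr_mat N r a) *\<^sub>v S) $ j"
      by simp
  qed (use S r in \<open>simp add: hankel_def glrr_mat_def\<close>)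
  then show ?thesis by (simp add: glrr_def)
qed

lemma glrr_space_eq_kernel:
  assumes "a \<in> carrier_vec (r + 1)" "r < N"
  shows "glrr_space N r a =
    {S \<in> carrier_vec N. transpose_mat (glrr_mat N r a) *\<^sub>v S = 0\<^sub>v (N - r)}"
  using glrr_iff[OF _ assms] by (auto simp: glrr_space_def)

text \<open>The square Toeplitz system that determines a series governed by \<open>a\<close> on the complement of
  \<open>idx_I N r \<tau>\<close> from its values on \<open>idx_I N r \<tau>\<close>.\<close>

definition glrr_core :: "nat \<Rightarrow> nat \<Rightarrow> nat \<Rightarrow> real vec \<Rightarrow> real mat" where
  "glrr_core N r \<tau> a = mat (N - r) (N - r) (\<lambda>(j, k). glrr_mat N r a $$ (\<tau> + k, j))"

lemma glrr_core_carrier [simp]: "glrr_core N r \<tau> a \<in> carrier_mat (N - r) (N - r)"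
  by (simp add: glrr_core_def)

text \<open>Positions in \<open>idx_I N r \<tau>\<close> contribute nothing, and the other rows of
  the banded matrix are, transposed, the core.\<close>

lemma glrr_mat_mult_zero_extension:
  assumes "\<tau> \<le> r" "r < N" and S: "S \<in> carrier_vec N" and 0: "\<And>i. i \<in> idx_I N r \<tau> \<Longrightarrow> S $ i = 0"
  shows "transpose_mat (glrr_mat N r a) *\<^sub>v S = glrr_core N r \<tau> a *\<^sub>v vec (N - r) (\<lambda>k. S $ (\<tau> + k))"
proof (rule eq_vecI)
  fix j assume "j < dim_vec (glrr_core N r \<tau> a *\<^sub>v vec (N - r) (\<lambda>k. S $ (\<tau> + k)))"
  then have j: "j < N - r" by (simp add: glrr_core_def)
  have "(transpose_mat (glrr_mat N r a) *\<^sub>v S) $ j = (\<Sum>i = 0..<N. glrr_mat N r a $$ (i, j) * S $ i)"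
    using j S by (simp add: scalar_prod_def glrr_mat_def)
  also have "\<dots> = (\<Sum>i = \<tau>..<\<tau> + (N - r). glrr_mat N r a $$ (i, j) * S $ i)"
    using assms by (intro sum.mono_neutral_right) (auto simp: idx_I_def)
  also have "\<dots> = (\<Sum>k = 0..<N - r. glrr_mat N r a $$ (\<tau> + k, j) * S $ (\<tau> + k))"
    by (subst sum.atLeastLessThan_shift_0) simp
  also have "\<dots> = (glrr_core N r \<tau> a *\<^sub>v vec (N - r) (\<lambda>k. S $ (\<tau> + k))) $ j"
    using j by (simp add: glrr_core_def scalar_prod_def)
  finally show "(transpose_mat (glrr_mat N r a) *\<^sub>v S) $ j =
      (glrr_core N r \<tau> a *\<^sub>v vec (N - r) (\<lambda>k. S $ (\<tau> + k))) $ j" .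
qed (simp add: glrr_core_def glrr_mat_def)

text \<open>The difference of the two series is governed by \<open>a\<close> and vanishes on
  \<open>idx_I N r \<tau>\<close>, so its remaining entries solve the homogeneous core
  system.\<close>

lemma glrr_core_nonsingular_unique:
  assumes r: "\<tau> \<le> r" "r < N" and det: "det (glrr_core N r \<tau> a) \<noteq> 0" and a: "a \<in> carrier_vec (r + 1)"
    and S: "S \<in> glrr_space N r a" and T: "T \<in> glrr_space N r a"
    and eq: "subvec S (idx_I N r \<tau>) = subvec T (idx_I N r \<tau>)"
  shows "S = T"
proof -
  let ?Q = "transpose_mat (glrr_mat N r a)"
  have Q: "?Q \<in> carrier_mat (N - r) N" by simp
  have ST: "S \<in> carrier_vec N" "T \<in> carrier_vec N" "?Q *\<^sub>v S = 0\<^sub>v (N - r)" "?Q *\<^sub>v T = 0\<^sub>v (N - r)"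
    using S T glrr_space_eq_kernel[OF a r(2)] by auto
  have I: "(S - T) $ i = 0" if "i \<in> idx_I N r \<tau>" for i
    using that eq subvec_eq_iff[OF ST(1,2) idx_I_subset] idx_I_subset[of N r \<tau>] ST(1,2) by auto
  let ?t = "vec (N - r) (\<lambda>k. (S - T) $ (\<tau> + k))"
  have "?Q *\<^sub>v (S - T) = 0\<^sub>v (N - r)"
    using ST mult_minus_distrib_mat_vec[OF Q ST(1,2)] by simp
  then have "glrr_core N r \<tau> a *\<^sub>v ?t = 0\<^sub>v (N - r)"
    using glrr_mat_mult_zero_extension[of \<tau> r N "S - T" a] r I ST by simp
  then have t: "?t = 0\<^sub>v (N - r)" using det_nonzeroD[OF glrr_core_carrier det] by simp
  show ?thesis
  proof (rule eq_vecI)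
    fix i assume "i < dim_vec T"
    then have i: "i < N" using ST by simp
    have "(S - T) $ i = 0"
    proof (cases "i \<in> idx_I N r \<tau>")
      case False
      then have "\<tau> \<le> i" "i - \<tau> < N - r" using i by (auto simp: idx_I_def)
      then show ?thesis using arg_cong[OF t, of "\<lambda>v. v $ (i - \<tau>)"] by simp
    qed (rule I)
    then show "S $ i = T $ i" using i ST by simp
  qed (use ST in simp)
qed

text \<open>The transposed core is a block of \<open>N - r\<close> consecutive rows of the banded
  matrix, so its nonsingularity forces full column rank.\<close>

lemma glrr_mat_inject:
  assumes "\<tau> \<le> r" "r < N" and det: "det (glrr_core N r \<tau> a) \<noteq> 0"
    and y: "y \<in> carrier_vec (N - r)" and 0: "glrr_mat N r a *\<^sub>v y = 0\<^sub>v N"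
  shows "y = 0\<^sub>v (N - r)"
proof (rule det_nonzeroD[of "transpose_mat (glrr_core N r \<tau> a)"])
  show "transpose_mat (glrr_core N r \<tau> a) *\<^sub>v y = 0\<^sub>v (N - r)"
  proof (rule eq_vecI)
    fix k assume "k < dim_vec (0\<^sub>v (N - r) :: real vec)"
    then have k: "k < N - r" by simp
    then have "\<tau> + k < N" using assms(1) by simp
    then have "(glrr_mat N r a *\<^sub>v y) $ (\<tau> + k) = 0" using 0 by simp
    then show "(transpose_mat (glrr_core N r \<tau> a) *\<^sub>v y) $ k = 0\<^sub>v (N - r) $ k"
      using k y \<open>\<tau> + k < N\<close> by (simp add: glrr_core_def glrr_mat_def scalar_prod_def)
  qed (simp add: glrr_core_def)
  show "det (transpose_mat (glrr_core N r \<tau> a)) \<noteq> 0"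
    using det det_transpose[OF glrr_core_carrier] by simp
qed (use y in simp_all)

text \<open>A kernel vector y of Q^T Q satisfies |Q y|^2 = 0, and \<open>Q\<close> is injective.
  This makes \<open>orth_proj_kernel\<close> applicable to the space governed by
  \<open>a\<close>.\<close>

lemma det_glrr_gram_nonzero:
  assumes r: "\<tau> \<le> r" "r < N" and det: "det (glrr_core N r \<tau> a) \<noteq> 0"
  shows "det (transpose_mat (glrr_mat N r a) * glrr_mat N r a) \<noteq> 0"
proof (rule det_nonzeroI)
  let ?Q = "glrr_mat N r a"
  fix y :: "real vec"
  assume y: "y \<in> carrier_vec (N - r)" and 0: "(transpose_mat ?Q * ?Q) *\<^sub>v y = 0\<^sub>v (N - r)"
  have Q: "?Q \<in> carrier_mat N (N - r)" "transpose_mat ?Q \<in> carrier_mat (N - r) N" by simp_all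
  have Qy: "?Q *\<^sub>v y \<in> carrier_vec N" using mult_mat_vec_carrier[OF Q(1) y] .
  have "(?Q *\<^sub>v y) \<bullet> (?Q *\<^sub>v y) = (transpose_mat ?Q *\<^sub>v (?Q *\<^sub>v y)) \<bullet> y"
    using transpose_vec_mult_scalar[OF Q(1) y Qy] by simp
  also have "transpose_mat ?Q *\<^sub>v (?Q *\<^sub>v y) = 0\<^sub>v (N - r)"
    using 0 assoc_mult_mat_vec[OF Q(2) Q(1) y] by simp
  finally have "?Q *\<^sub>v y = 0\<^sub>v N" using scalar_prod_self_eq_0[OF Qy] y by simp
  then show "y = 0\<^sub>v (N - r)" using glrr_mat_inject[OF assms y] by simp
qed (simp add: mult_carrier_mat[of _ _ N])

text \<open>\<open>basis_cols\<close> refers to the module with carrier \<open>W\<close>. As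
  \<open>W\<close> is a submodule, independence there is independence in the full space.\<close>

lemma basis_cols_in_space:
  assumes "basis_cols n W Z" "W = {v \<in> carrier_vec n. A *\<^sub>v v = 0\<^sub>v m}" "A \<in> carrier_mat m n"
  shows "set (cols Z) \<subseteq> W" "\<not> module.lin_dep class_ring (module_vec TYPE(real) n) (set (cols Z))"
proof -
  interpret vec_space "TYPE(real)" n .
  have sub: "submodule class_ring W V"
    unfolding submodule_def
    using assms(2,3) module_axioms
    by (auto simp: mult_add_distrib_mat_vec[of _ m n] mult_mat_vec[of _ m n] module_vec_simps)
  then have vs: "vectorspace class_ring (vs W)"
    using subspace_is_vs[of W] vectorspace_axioms by (simp add: subspace_def)
  have b: "vectorspace.basis class_ring (vs W) (set (cols Z))"
    using assms(1) by (simp add: basis_cols_def)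
  then show W: "set (cols Z) \<subseteq> W" using vectorspace.basis_def[OF vs] by auto
  show "lin_indpt (set (cols Z))"
    using b vectorspace.basis_def[OF vs] span_li_not_depend(2)[OF W sub] by auto
qed

lemma glrr_basis:
  assumes Z0: "Z0 \<in> carrier_mat N r" and b: "basis_cols N (glrr_space N r a) Z0"
    and a: "a \<in> carrier_vec (r + 1)" and r: "r < N" and x: "x \<in> carrier_vec r"
  shows "transpose_mat (glrr_mat N r a) *\<^sub>v (Z0 *\<^sub>v x) = 0\<^sub>v (N - r)"
    and "Z0 *\<^sub>v x = 0\<^sub>v N \<Longrightarrow> x = 0\<^sub>v r"
proof -
  interpret vec_space "TYPE(real)" N .
  let ?Q = "transpose_mat (glrr_mat N r a)"
  have Q: "?Q \<in> carrier_mat (N - r) N" by simp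
  note * = basis_cols_in_space[OF b glrr_space_eq_kernel[OF a r] Q]
  have d: "distinct (cols Z0)" using b by (simp add: basis_cols_def)
  show "Z0 *\<^sub>v x = 0\<^sub>v N \<Longrightarrow> x = 0\<^sub>v r" using lin_depI[OF Z0 x _ _ d] *(2) by blast
  have "?Q * Z0 = 0\<^sub>m (N - r) r"
  proof (rule eq_matI)
    fix i j assume "i < dim_row (0\<^sub>m (N - r) r :: real mat)" "j < dim_col (0\<^sub>m (N - r) r :: real mat)"
    then have ij: "i < N - r" "j < r" by auto
    then have "col Z0 j \<in> set (cols Z0)" using Z0 by (auto simp: cols_def)
    then have "col Z0 j \<in> glrr_space N r a" using *(1) by blast
    then have "?Q *\<^sub>v col Z0 j = 0\<^sub>v (N - r)" using glrr_space_eq_kernel[OF a r] by simp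
    then have "(?Q *\<^sub>v col Z0 j) $ i = 0" using ij by simp
    then show "(?Q * Z0) $$ (i, j) = 0\<^sub>m (N - r) r $$ (i, j)" using ij Z0 Q by simp
  qed (use Z0 in \<open>simp_all add: glrr_mat_def\<close>)
  then show "?Q *\<^sub>v (Z0 *\<^sub>v x) = 0\<^sub>v (N - r)"
    using assoc_mult_mat_vec[OF Q Z0 x, symmetric] x by simp (auto intro!: eq_vecI)
qed

section \<open>Series of rank r: the normalized recurrence is unique\<close>

text \<open>The Hankel matrix has \<open>r + 1\<close> rows, so rank \<open>r\<close> is corank one.
  Among the series governed by a fixed \<open>a\<close>, membership in
  \<open>series_rank N r\<close> thus becomes an open condition.\<close>

lemma series_rank_iff_det:
  assumes S: "S \<in> carrier_vec N" and r: "r < N" and a: "a \<in> carrier_vec (r + 1)" "a \<noteq> 0\<^sub>v (r + 1)"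
    and g: "glrr N r a S"
  shows "S \<in> series_rank N r \<longleftrightarrow> det (bordered_gram (r + 1) (hankel (r + 1) S) a) \<noteq> 0"
  using det_bordered_gram_iff[OF hankel_carrier[OF S r] a] g S
  by (auto simp: glrr_def series_rank_def)

text \<open>With corank one the left kernel of the Hankel matrix is a line, and the entry -1 at
  \<tau> selects one point of it.\<close>

lemma glrr_unique:
  assumes S: "S \<in> series_rank N r" and r: "r < N" "\<tau> \<le> r"
    and a: "a \<in> carrier_vec (r + 1)" "a $ \<tau> = - 1" "glrr N r a S"
    and b: "b \<in> carrier_vec (r + 1)" "b $ \<tau> = - 1" "glrr N r b S"
  shows "a = b"
proof -
  let ?H = "hankel (r + 1) S"
  have Sc: "S \<in> carrier_vec N" using S by (simp add: series_rank_def)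
  have H: "?H \<in> carrier_mat (r + 1) (N - r)" "transpose_mat ?H \<in> carrier_mat (N - r) (r + 1)"
    using hankel_carrier[OF Sc r(1)] by simp_all
  have a0: "a \<noteq> 0\<^sub>v (r + 1)" using a(2) r by auto
  have det: "det (bordered_gram (r + 1) ?H a) \<noteq> 0" using series_rank_iff_det[OF Sc r(1) a(1) a0 a(3)] S by simp
  \<comment> \<open>Up to the factor \<open>a \<bullet> a\<close>, this is the component of
    \<open>b\<close> orthogonal to \<open>a\<close>. Both summands of the bordered Gram matrix
    annihilate it.\<close>
  define w where "w = (a \<bullet> a) \<cdot>\<^sub>v b - (a \<bullet> b) \<cdot>\<^sub>v a"
  have w: "w \<in> carrier_vec (r + 1)" using a b by (simp add: w_def)
  have "transpose_mat ?H *\<^sub>v w = 0\<^sub>v (N - r)"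
    using a b mult_minus_distrib_mat_vec[OF H(2)] mult_mat_vec[OF H(2)]
    by (simp add: w_def glrr_def) (auto intro!: eq_vecI)
  moreover have "a \<bullet> w = 0"
    using a b by (simp add: w_def scalar_prod_minus_distrib[of _ "r + 1"])
  ultimately have "bordered_gram (r + 1) ?H a *\<^sub>v w = 0\<^sub>v (r + 1)"
    using bordered_gram_mult_vec[OF H(1) a(1) w] H a by (auto intro!: eq_vecI)
  then have w0: "w = 0\<^sub>v (r + 1)" using det_nonzeroD[OF bordered_gram_carrier[OF H(1)] det w] by simp
  have wi: "(a \<bullet> a) * b $ i = (a \<bullet> b) * a $ i" if "i < r + 1" for i
    using arg_cong[OF w0, of "\<lambda>v. v $ i"] that a b by (simp add: w_def)
  have "a \<bullet> a = a \<bullet> b" using wi[of \<tau>] r a b by simp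
  moreover have "a \<bullet> a \<noteq> 0" using a0 scalar_prod_self_eq_0[OF a(1)] by blast
  ultimately show "a = b" using wi a b by (intro eq_vecI) auto
qed

text \<open>The column space is the hyperplane orthogonal to \<open>a\<close>, so the complementary
  projection maps \<open>b\<close> to its component along \<open>a\<close>, with coefficient (a . b)
  / (a . a). The hyperplane is treated as the kernel of Q^T, where the only column of
  \<open>Q\<close> is \<open>a\<close>.\<close>

lemma orth_proj_col_space:
  assumes S: "S \<in> series_rank N r" and r: "r < N" and a: "a \<in> carrier_vec (r + 1)" "glrr N r a S"
    and b: "b \<in> carrier_vec (r + 1)" and ab: "a \<bullet> b \<noteq> 0"
  obtains c where "c \<noteq> 0"
    "(1\<^sub>m (r + 1) - orth_proj (r + 1) (vec_space.col_space (r + 1) (hankel (r + 1) S))) *\<^sub>v b = c \<cdot>\<^sub>v a"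
proof -
  let ?H = "hankel (r + 1) S" and ?n = "r + 1"
  define Q where "Q = mat ?n 1 (\<lambda>(i, j). a $ i)"
  define P where "P = orth_proj ?n (vec_space.col_space ?n ?H)"
  have Sc: "S \<in> carrier_vec N" using S by (simp add: series_rank_def)
  have a0: "a \<noteq> 0\<^sub>v ?n" using ab b by auto
  have Q: "Q \<in> carrier_mat ?n 1" by (simp add: Q_def)
  have QT: "transpose_mat Q *\<^sub>v v = vec 1 (\<lambda>_. a \<bullet> v)" if "v \<in> carrier_vec ?n" for v
    using that a by (auto simp: Q_def scalar_prod_def intro!: eq_vecI)
  have Qy: "Q *\<^sub>v y = (y $ 0) \<cdot>\<^sub>v a" if "y \<in> carrier_vec 1" for y
    using that a by (auto simp: Q_def scalar_prod_def intro!: eq_vecI)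
  have "vec_space.col_space ?n ?H = {v \<in> carrier_vec ?n. a \<bullet> v = 0}"
    using a a0 S by (intro col_space_eq_orthogonal[OF hankel_carrier[OF Sc r]]) (auto simp: glrr_def series_rank_def)
  also have "\<dots> = {v \<in> carrier_vec ?n. transpose_mat Q *\<^sub>v v = 0\<^sub>v 1}"
  proof -
    have "vec 1 (\<lambda>_. c) = 0\<^sub>v 1 \<longleftrightarrow> c = 0" for c :: real
      by (auto simp: vec_eq_iff)
    then show ?thesis using QT by auto
  qed
  finally have L: "vec_space.col_space ?n ?H = {v \<in> carrier_vec ?n. transpose_mat Q *\<^sub>v v = 0\<^sub>v 1}" .
  have "det (transpose_mat Q * Q) = a \<bullet> a"
    using Q a by (subst det_single) (auto simp: Q_def scalar_prod_def)
  then have "det (transpose_mat Q * Q) \<noteq> 0" using a0 scalar_prod_self_eq_0[OF a(1)] by auto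
  note P = orth_proj_kernel[OF Q this, folded L P_def]
  obtain y where y: "y \<in> carrier_vec 1" "b - P *\<^sub>v b = Q *\<^sub>v y" using P(3)[OF b] by blast
  have Pb: "P *\<^sub>v b \<in> carrier_vec ?n" using P(1) b by simp
  have eq: "b - P *\<^sub>v b = (y $ 0) \<cdot>\<^sub>v a" using y Qy by simp
  have "a \<bullet> (P *\<^sub>v b) = 0" using arg_cong[OF P(2)[OF b], of "\<lambda>v. v $ 0"] QT[OF Pb] by simp
  then have "a \<bullet> b = a \<bullet> (b - P *\<^sub>v b)"
    using scalar_prod_minus_distrib[OF a(1) b Pb] by simp
  then have "a \<bullet> b = y $ 0 * (a \<bullet> a)" using eq a by simp
  then have "y $ 0 \<noteq> 0" using ab by auto
  moreover have "(1\<^sub>m ?n - P) *\<^sub>v b = (y $ 0) \<cdot>\<^sub>v a"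
    using minus_mult_distrib_mat_vec[OF one_carrier_mat P(1) b] b eq by simp
  ultimately show ?thesis using that unfolding P_def by blast
qed

section \<open>A local parameterization forces a nonsingular core\<close>

text \<open>If the core were singular, \<open>S0\<close> could be moved within the variety along a series of the
  kernel vanishing on \<open>idx_I N r \<tau>\<close>, without changing either parameter.\<close>

lemma local_param_core_nonsingular:
  assumes r: "r < N" "\<tau> \<le> r" and a0: "a0 \<in> carrier_vec (r + 1)" "a0 $ \<tau> = - 1"
    and S0: "S0 \<in> series_rank N r" "glrr N r a0 S0"
    and lp: "local_param N r \<tau> S0 a0 U P"
  shows "det (glrr_core N r \<tau> a0) \<noteq> 0"
proof
  assume "det (glrr_core N r \<tau> a0) = 0"
  then obtain t where t: "t \<in> carrier_vec (N - r)" "t \<noteq> 0\<^sub>v (N - r)"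
    "glrr_core N r \<tau> a0 *\<^sub>v t = 0\<^sub>v (N - r)"
    using det_0_iff_vec_prod_zero_field[OF glrr_core_carrier] by blast
  \<comment> \<open>The kernel vector of the core, extended by zero on
    \<open>idx_I N r \<tau>\<close>, is a nonzero series governed by \<open>a0\<close>.\<close>
  define D where "D = vec N (\<lambda>i. if \<tau> \<le> i \<and> i < \<tau> + (N - r) then t $ (i - \<tau>) else 0)"
  have D: "D \<in> carrier_vec N" by (simp add: D_def)
  have DI: "D $ i = 0" if "i \<in> idx_I N r \<tau>" for i using that by (auto simp: D_def idx_I_def)
  have tD: "vec (N - r) (\<lambda>k. D $ (\<tau> + k)) = t" using t(1) r by (auto simp: D_def intro!: eq_vecI)
  have D0: "D \<noteq> 0\<^sub>v N"
  proof
    assume "D = 0\<^sub>v N"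
    then have "t = 0\<^sub>v (N - r)" unfolding tD[symmetric] using r by (auto intro!: eq_vecI)
    then show False using t(2) by simp
  qed
  let ?Q = "transpose_mat (glrr_mat N r a0)"
  have Q: "?Q \<in> carrier_mat (N - r) N" by simp
  have QD: "?Q *\<^sub>v D = 0\<^sub>v (N - r)"
    using glrr_mat_mult_zero_extension[OF r(2,1) D DI] tD t(3) by simp
  have S0c: "S0 \<in> carrier_vec N" using S0 by (simp add: series_rank_def)
  have QS0: "?Q *\<^sub>v S0 = 0\<^sub>v (N - r)" using glrr_iff[OF S0c a0(1) r(1)] S0(2) by simp
  let ?S = "\<lambda>e. S0 + e \<cdot>\<^sub>v D"
  have Sc: "?S e \<in> carrier_vec N" for e using S0c D by simp
  have g: "glrr N r a0 (?S e)" for e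
    using glrr_iff[OF Sc a0(1) r(1)] mult_add_distrib_mat_vec[OF Q S0c, of "e \<cdot>\<^sub>v D"]
      mult_mat_vec[OF Q D] QD QS0 D by simp (auto intro!: eq_vecI)
  have a0n: "a0 \<noteq> 0\<^sub>v (r + 1)" using a0 r by auto
  \<comment> \<open>Since \<open>a0\<close> governs every point of the line, rank \<open>r\<close>
    along it is the nonvanishing of a determinant that is continuous in \<open>e\<close>.\<close>
  let ?B = "\<lambda>S. bordered_gram (r + 1) (hankel (r + 1) S) a0"
  have "((\<lambda>e. det (?B (?S e))) \<longlongrightarrow> det (?B S0)) (at 0)"
  proof (rule tendsto_det)
    fix i j assume ij: "i < r + 1" "j < r + 1"
    have B: "?B S $$ (i, j) = (\<Sum>k = 0..<N - r. S $ (i + k) * S $ (j + k)) + a0 $ i * a0 $ j"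
      if "S \<in> carrier_vec N" for S
      using ij unfolding bordered_gram_def hankel_eq[OF that r(1)] by (simp add: scalar_prod_def)
    have "((\<lambda>e. ?S e $ k) \<longlongrightarrow> S0 $ k) (at 0)" if "k < N" for k
      using that S0c D by (auto intro!: tendsto_eq_intros)
    then show "((\<lambda>e. ?B (?S e) $$ (i, j)) \<longlongrightarrow> ?B S0 $$ (i, j)) (at 0)"
      unfolding B[OF Sc] B[OF S0c] using ij by (intro tendsto_intros) auto
  qed (use hankel_carrier[OF _ r(1)] bordered_gram_carrier Sc S0c in blast)+
  moreover have "det (?B S0) \<noteq> 0" using series_rank_iff_det[OF S0c r(1) a0(1) a0n S0(2)] S0(1) by simp
  ultimately have "\<forall>\<^sub>F e in at 0. det (?B (?S e)) \<noteq> 0" by (rule tendsto_imp_eventually_ne)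
  then have evD: "\<forall>\<^sub>F e in at 0. ?S e \<in> series_rank N r"
    using series_rank_iff_det[OF Sc r(1) a0(1) a0n g] by simp
  obtain V where V: "nbhd N S0 V" "bij_betw P U (V \<inter> series_rank N r)"
    using lp by (auto simp: local_param_def)
  have evV: "\<forall>\<^sub>F e in at 0. ?S e \<in> V"
    using V(1) eventually_vec_nhds_line[OF _ S0c D, of "\<lambda>S. S \<in> V"] by (simp add: nbhd_iff_eventually)
  have "\<forall>\<^sub>F e in at (0::real). e \<noteq> 0" by (simp add: eventually_at_filter)
  with evD evV have "\<forall>\<^sub>F e in at 0. ?S e \<in> series_rank N r \<and> ?S e \<in> V \<and> e \<noteq> 0"
    by eventually_elim simp
  then obtain e where e: "?S e \<in> series_rank N r" "?S e \<in> V" "e \<noteq> 0"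
    using eventually_happens'[OF at_neq_bot] by blast
  have S0V: "S0 \<in> V" using V(1) S0c eventually_vec_nhds_self by (auto simp: nbhd_iff_eventually)
  \<comment> \<open>A series in the image that is governed by \<open>a0\<close> has only one
    possible parameter: its first half is the restriction to \<open>idx_I N r \<tau>\<close>, and
    its second half is fixed by \<open>glrr_unique\<close>. \<open>S0\<close> and the shifted series
    therefore have the same parameter and must coincide.\<close>
  have params: "\<exists>s\<in>carrier_vec r. s = subvec S (idx_I N r \<tau>) \<and> s @\<^sub>v subvec a0 (idx_K r \<tau>) \<in> U \<and>
      P (s @\<^sub>v subvec a0 (idx_K r \<tau>)) = S"
    if S: "S \<in> V \<inter> series_rank N r" "glrr N r a0 S" for S
  proof -
    obtain y where y: "y \<in> U" "P y = S" using V(2) S(1) unfolding bij_betw_def by (metis imageE)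
    have "y \<in> carrier_vec (2 * r)" using lp y(1) by (auto simp: local_param_def nbhd_def)
    then have "y = vec_first y r @\<^sub>v vec_last y r" by (simp add: mult_2)
    then obtain s a where sa: "s \<in> carrier_vec r" "a \<in> carrier_vec r" "y = s @\<^sub>v a"
      by (metis vec_first_carrier vec_last_carrier)
    then have "subvec S (idx_I N r \<tau>) = s" "glrr N r (insert_minus_one r \<tau> a) S"
      using lp y by (auto simp: local_param_def)
    moreover from this have "insert_minus_one r \<tau> a = a0"
      using glrr_unique[OF _ r insert_minus_one_carrier insert_minus_one_index[OF r(2)] _ a0, of S a] S
      by blast
    then have "a = subvec a0 (idx_K r \<tau>)" using subvec_insert_minus_one[OF sa(2) r(2)] by simp
    ultimately show ?thesis using sa y by auto
  qed
  have "subvec (?S e) (idx_I N r \<tau>) = subvec S0 (idx_I N r \<tau>)"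
    using subvec_eq_iff[OF Sc S0c idx_I_subset] DI idx_I_subset[of N r \<tau>] S0c D by auto
  then have Se: "?S e = S0"
    using params[of "?S e"] params[of S0] e S0V S0 g by auto
  obtain i where i: "i < N" "D $ i \<noteq> 0" using D0 D by (auto simp: vec_eq_iff)
  then have "?S e $ i = S0 $ i + e * D $ i" using S0c D by simp
  then show False unfolding Se using i(2) e(3) by simp
qed

section \<open>The explicit parameterization and its inverse\<close>

theorem proposition2p1:
  fixes N r \<tau> :: nat
    and a0 S0 :: "real vec"
    and Z0 :: "real mat"
    and U :: "real vec set"
    and S\<tau> :: "real vec \<Rightarrow> real vec"
  assumes "1 \<le> r" and "2 * r < N" and "\<tau> \<in> {0..r}"
    and "a0 \<in> carrier_vec (r + 1)" and "a0 $ \<tau> = - 1"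
    and "S0 \<in> series_rank N r" and "glrr N r a0 S0"
    and "Z0 \<in> carrier_mat N r" and "basis_cols N (glrr_space N r a0) Z0"
    and "local_param N r \<tau> S0 a0 U S\<tau>"
  shows "\<exists>W. nbhd (2 * r) (param_center N r \<tau> S0 a0) W \<and> W \<subseteq> U \<and>
    (\<forall>s \<in> carrier_vec r. \<forall>a \<in> carrier_vec r. s @\<^sub>v a \<in> W \<longrightarrow>
      (let Z = orth_proj N (glrr_space N r (insert_minus_one r \<tau> a)) * Z0;
           ZI = submatrix Z (idx_I N r \<tau>) UNIV;
           G = Z * the (mat_inverse ZI)
       in ZI \<in> carrier_mat r r \<and> invertible_mat ZI \<and> S\<tau> (s @\<^sub>v a) = G *\<^sub>v s) \<and>
      (\<forall>S. S = S\<tau> (s @\<^sub>v a) \<longrightarrow>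
        (let \<L> = vec_space.col_space (r + 1) (hankel (r + 1) S);
             a_hat = (1\<^sub>m (r + 1) - orth_proj (r + 1) \<L>) *\<^sub>v a0
         in a_hat $ \<tau> \<noteq> 0 \<and>
            s = subvec S (idx_I N r \<tau>) \<and>
            a = subvec ((- 1 / a_hat $ \<tau>) \<cdot>\<^sub>v a_hat) (idx_K r \<tau>))))"
proof -
  have r: "\<tau> \<le> r" "r < N" "r \<le> N" using assms(2,3) by auto
  note a0 = assms(4,5) and lp = assms(10)
  have S0c: "S0 \<in> carrier_vec N" using assms(6) by (simp add: series_rank_def)
  let ?c = "param_center N r \<tau> S0 a0"
  let ?F = "vec_nhds (2 * r) ?c"
  let ?Q = "glrr_mat N r"
  \<comment> \<open>The recurrence belonging to a point of the parameter space, as a function of the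
    concatenated vector.\<close>
  define H where "H y = insert_minus_one r \<tau> (vec_last y r)" for y
  have Hc: "H y \<in> carrier_vec (r + 1)" for y unfolding H_def by (rule insert_minus_one_carrier)
  have Hsa: "H (s @\<^sub>v a) = insert_minus_one r \<tau> a" if "s \<in> carrier_vec r" "a \<in> carrier_vec r" for s a
  proof -
    have "vec_last (s @\<^sub>v a) r = a" using that by (auto simp: vec_last_def intro!: eq_vecI)
    then show ?thesis by (simp add: H_def)
  qed
  have a0K: "subvec a0 (idx_K r \<tau>) \<in> carrier_vec r" using subvec_idx_K[OF a0(1) r(1)] by simp
  have Hcen: "H ?c = a0"
    using Hsa[OF subvec_idx_I_carrier[OF S0c r(1,3)] a0K] insert_minus_one_subvec[OF a0(1) r(1) a0(2)]
    by (simp add: param_center_def)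
  have dim: "dim_vec ?c = 2 * r"
    using carrier_vecD[OF subvec_idx_I_carrier[OF S0c r(1,3)]] carrier_vecD[OF a0K]
    by (simp add: param_center_def)
  have H_tendsto: "((\<lambda>y. H y $ i) \<longlongrightarrow> a0 $ i) ?F" if "i < r + 1" for i
  proof -
    have in_car: "\<forall>\<^sub>F y in ?F. y \<in> carrier_vec (2 * r)"
      by (auto simp: eventually_vec_nhds intro: exI[of _ 1])
    \<comment> \<open>\<open>vec_last\<close> depends on the dimension of its argument. For vectors
      of dimension \<open>2 * r\<close>, which holds eventually, an entry of \<open>H y\<close> is
      the constant -1 or one fixed coordinate of \<open>y\<close>.\<close>
    define h where "h y = (if i < \<tau> then y $ (r + i) else if i = \<tau> then - 1 else y $ (r + (i - 1)))"
      for y :: "real vec"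
    have hH: "h y = H y $ i" if "dim_vec y = 2 * r" for y
      using that \<open>i < r + 1\<close> r(1) by (auto simp: h_def H_def insert_minus_one_def vec_last_def mult_2)
    have "(h \<longlongrightarrow> h ?c) ?F"
      unfolding h_def using that r(1)
      by (cases "i < \<tau>"; cases "i = \<tau>") (auto intro!: tendsto_vec_index)
    moreover have "h ?c = a0 $ i" using hH[OF dim] Hcen by simp
    moreover have "\<forall>\<^sub>F y in ?F. h y = H y $ i" using in_car by eventually_elim (simp add: hH)
    ultimately show ?thesis using tendsto_cong[of h "\<lambda>y. H y $ i" ?F "a0 $ i"] by simp
  qed
  have Q_tendsto: "((\<lambda>y. ?Q (H y) $$ (i, j)) \<longlongrightarrow> ?Q a0 $$ (i, j)) ?F" if "i < N" "j < N - r" for i j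
    using that H_tendsto[of "i - j"] by (auto simp: glrr_mat_def)
  have core: "det (glrr_core N r \<tau> a0) \<noteq> 0"
    using local_param_core_nonsingular[OF r(2,1) a0 assms(6,7) lp] .
  have "((\<lambda>y. det (glrr_core N r \<tau> (H y))) \<longlongrightarrow> det (glrr_core N r \<tau> a0)) ?F"
    using r by (intro tendsto_det[where n = "N - r"]) (auto simp: glrr_core_def intro!: Q_tendsto)
  then have ev1: "\<forall>\<^sub>F y in ?F. det (glrr_core N r \<tau> (H y)) \<noteq> 0"
    using core by (rule tendsto_imp_eventually_ne)
  have QQ: "transpose_mat (?Q a0) * ?Q a \<in> carrier_mat (N - r) (N - r)" for a
    by (simp add: mult_carrier_mat[of _ _ N])
  \<comment> \<open>Only the second factor varies. At the center the product is the Gram matrix of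
    \<open>?Q a0\<close>, nonsingular because the core is.\<close>
  have "((\<lambda>y. det (transpose_mat (?Q a0) * ?Q (H y))) \<longlongrightarrow> det (transpose_mat (?Q a0) * ?Q a0)) ?F"
  proof (rule tendsto_det)
    fix i j assume ij: "i < N - r" "j < N - r"
    have "(transpose_mat (?Q a0) * ?Q a) $$ (i, j) = (\<Sum>k = 0..<N. ?Q a0 $$ (k, i) * ?Q a $$ (k, j))" for a
      using ij by (simp add: scalar_prod_def glrr_mat_def)
    then show "((\<lambda>y. (transpose_mat (?Q a0) * ?Q (H y)) $$ (i, j)) \<longlongrightarrow>
        (transpose_mat (?Q a0) * ?Q a0) $$ (i, j)) ?F"
      using ij by (auto intro!: tendsto_intros Q_tendsto)
  qed (use QQ in blast)+
  then have ev2: "\<forall>\<^sub>F y in ?F. det (transpose_mat (?Q a0) * ?Q (H y)) \<noteq> 0"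
    using det_glrr_gram_nonzero[OF r(1,2) core] by (rule tendsto_imp_eventually_ne)
  have "((\<lambda>y. H y \<bullet> a0) \<longlongrightarrow> a0 \<bullet> a0) ?F"
    unfolding scalar_prod_def using a0(1) by (auto intro!: tendsto_intros H_tendsto)
  moreover have "a0 \<bullet> a0 \<noteq> 0" using scalar_prod_self_eq_0[OF a0(1)] a0(2) r by auto
  ultimately have ev3: "\<forall>\<^sub>F y in ?F. H y \<bullet> a0 \<noteq> 0" by (rule tendsto_imp_eventually_ne)
  \<comment> \<open>The first condition makes series governed by \<open>H y\<close> unique given
    their values on \<open>idx_I N r \<tau>\<close>. The second makes the projection injective on
    the space of \<open>a0\<close>. The third keeps the projected \<open>a0\<close> of the inverse
    formula nonzero.\<close>
  define W where "W = {y \<in> U. det (glrr_core N r \<tau> (H y)) \<noteq> 0 \<and>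
      det (transpose_mat (?Q a0) * ?Q (H y)) \<noteq> 0 \<and> H y \<bullet> a0 \<noteq> 0}"
  have U: "U \<subseteq> carrier_vec (2 * r)" "\<forall>\<^sub>F y in ?F. y \<in> U"
    using lp by (auto simp: local_param_def nbhd_iff_eventually)
  have W: "nbhd (2 * r) ?c W"
    unfolding nbhd_iff_eventually W_def
  proof
    show "\<forall>\<^sub>F y in ?F. y \<in> {y \<in> U. det (glrr_core N r \<tau> (H y)) \<noteq> 0 \<and>
      det (transpose_mat (?Q a0) * ?Q (H y)) \<noteq> 0 \<and> H y \<bullet> a0 \<noteq> 0}"
      using U(2) ev1 ev2 ev3 by eventually_elim simp
  qed (use U in auto)
  have WU: "W \<subseteq> U" by (auto simp: W_def)
  have S_rank: "S\<tau> y \<in> series_rank N r" if "y \<in> W" for y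
    using lp that WU unfolding local_param_def by (metis IntD2 bij_betwE subsetD)
  have main1: "ZI \<in> carrier_mat r r \<and> invertible_mat ZI \<and>
      S\<tau> (s @\<^sub>v a) = (Z * the (mat_inverse ZI)) *\<^sub>v s"
    if s: "s \<in> carrier_vec r" and a: "a \<in> carrier_vec r" and sa: "s @\<^sub>v a \<in> W"
      and Z: "Z = orth_proj N (glrr_space N r (insert_minus_one r \<tau> a)) * Z0"
      and ZI: "ZI = submatrix Z (idx_I N r \<tau>) UNIV" for s a Z ZI
  proof -
    let ?a = "insert_minus_one r \<tau> a"
    have ac: "?a \<in> carrier_vec (r + 1)" by (rule insert_minus_one_carrier)
    have d1: "det (glrr_core N r \<tau> ?a) \<noteq> 0" and d2: "det (transpose_mat (?Q a0) * ?Q ?a) \<noteq> 0"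
      using sa Hsa[OF s a] by (auto simp: W_def)
    have Qc: "?Q ?a \<in> carrier_mat N (N - r)" by simp
    note P = orth_proj_kernel[OF Qc det_glrr_gram_nonzero[OF r(1,2) d1],
        folded glrr_space_eq_kernel[OF ac r(2)]]
    let ?P = "orth_proj N (glrr_space N r ?a)"
    have Zc: "Z \<in> carrier_mat N r" using P(1) assms(8) by (simp add: Z)
    have Zx: "Z *\<^sub>v x = ?P *\<^sub>v (Z0 *\<^sub>v x)" if "x \<in> carrier_vec r" for x
      unfolding Z using assoc_mult_mat_vec[OF P(1) assms(8) that] .
    have Z0x: "Z0 *\<^sub>v x \<in> carrier_vec N" if "x \<in> carrier_vec r" for x using assms(8) that by simp
    have Zx_in: "Z *\<^sub>v x \<in> glrr_space N r ?a" if "x \<in> carrier_vec r" for x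
    proof -
      have "v \<in> glrr_space N r ?a"
        if "v \<in> carrier_vec N" "transpose_mat (?Q ?a) *\<^sub>v v = 0\<^sub>v (N - r)" for v
        using that glrr_space_eq_kernel[OF ac r(2)] by simp
      then show ?thesis
        unfolding Zx[OF that] using P(2)[OF Z0x[OF that]] mult_mat_vec_carrier[OF P(1) Z0x[OF that]]
        by blast
    qed
    have card: "{i. i < N \<and> i \<in> idx_I N r \<tau>} = idx_I N r \<tau>" using idx_I_subset[of N r \<tau>] by auto
    have ZIc: "ZI \<in> carrier_mat r r"
      using Zc card card_idx_I[OF r(1,3)] by (auto simp: ZI submatrix_def)
    have ZIx: "ZI *\<^sub>v x = subvec (Z *\<^sub>v x) (idx_I N r \<tau>)" if "x \<in> carrier_vec r" for x
      unfolding ZI using submatrix_mult_vec[OF Zc that] .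
    \<comment> \<open>If \<open>Z *\<^sub>v x\<close> vanishes on \<open>idx_I N r \<tau>\<close>,
      it equals the zero series by uniqueness, so \<open>Z0 *\<^sub>v x\<close> projects to
      0.\<close>
    have det: "det ZI \<noteq> 0"
    proof (rule det_nonzeroI[OF ZIc])
      fix x :: "real vec" assume x: "x \<in> carrier_vec r" and 0: "ZI *\<^sub>v x = 0\<^sub>v r"
      have Z_0: "Z *\<^sub>v 0\<^sub>v r = 0\<^sub>v N" using mult_mat_zero_vec[OF Zc] .
      then have z: "0\<^sub>v N \<in> glrr_space N r ?a" using Zx_in[of "0\<^sub>v r"] by simp
      have "ZI *\<^sub>v 0\<^sub>v r = 0\<^sub>v r" using mult_mat_zero_vec[OF ZIc] .
      then have "subvec (Z *\<^sub>v x) (idx_I N r \<tau>) = subvec (0\<^sub>v N) (idx_I N r \<tau>)"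
        using 0 ZIx[OF x] ZIx[of "0\<^sub>v r"] Z_0 by simp
      then have "Z *\<^sub>v x = 0\<^sub>v N"
        using glrr_core_nonsingular_unique[OF r(1,2) d1 ac Zx_in[OF x] z] by simp
      then have P0: "?P *\<^sub>v (Z0 *\<^sub>v x) = 0\<^sub>v N" using Zx[OF x] by simp
      \<comment> \<open>A vector projecting to 0 lies in the range of the banded matrix of
        \<open>?a\<close>. The transposed matrix of \<open>a0\<close> annihilates it, so
        \<open>y\<close> solves the nonsingular mixed system.\<close>
      obtain y where y: "y \<in> carrier_vec (N - r)" "Z0 *\<^sub>v x - ?P *\<^sub>v (Z0 *\<^sub>v x) = ?Q ?a *\<^sub>v y"
        using P(3)[OF Z0x[OF x]] by blast
      then have eq: "Z0 *\<^sub>v x = ?Q ?a *\<^sub>v y" using P0 Z0x[OF x] by simp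
      have QT: "transpose_mat (?Q a0) \<in> carrier_mat (N - r) N" by simp
      have "(transpose_mat (?Q a0) * ?Q ?a) *\<^sub>v y = 0\<^sub>v (N - r)"
        using glrr_basis(1)[OF assms(8,9) a0(1) r(2) x] eq assoc_mult_mat_vec[OF QT Qc y(1)] by simp
      then have "y = 0\<^sub>v (N - r)" using det_nonzeroD[OF QQ d2 y(1)] by simp
      then have "Z0 *\<^sub>v x = 0\<^sub>v N" using eq mult_mat_zero_vec[OF Qc] by simp
      then show "x = 0\<^sub>v r" using glrr_basis(2)[OF assms(8,9) a0(1) r(2) x] by simp
    qed
    obtain B where B: "mat_inverse ZI = Some B" "B \<in> carrier_mat r r" "ZI * B = 1\<^sub>m r" "B * ZI = 1\<^sub>m r"
      using det_nonzero_inverse[OF ZIc det] by blast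
    have inv: "invertible_mat ZI"
      using B ZIc by (auto simp: invertible_mat_def inverts_mat_def intro!: exI[of _ B])
    let ?S = "S\<tau> (s @\<^sub>v a)"
    have S: "subvec ?S (idx_I N r \<tau>) = s" "glrr N r ?a ?S"
      using lp s a sa WU by (auto simp: local_param_def)
    have Sin: "?S \<in> glrr_space N r ?a" using S S_rank[OF sa] by (auto simp: glrr_space_def series_rank_def)
    have Bs: "B *\<^sub>v s \<in> carrier_vec r" using B s by simp
    \<comment> \<open>This candidate is governed by \<open>?a\<close> and restricts to
      \<open>s\<close>, as the value of \<open>S\<tau>\<close> does; uniqueness identifies the
      two.\<close>
    have "subvec (Z *\<^sub>v (B *\<^sub>v s)) (idx_I N r \<tau>) = s"
      using ZIx[OF Bs] assoc_mult_mat_vec[OF ZIc B(2) s] B(3) s by simp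
    then have "?S = Z *\<^sub>v (B *\<^sub>v s)"
      using glrr_core_nonsingular_unique[OF r(1,2) d1 ac Sin Zx_in[OF Bs]] S(1) by simp
    then show ?thesis using ZIc inv B(1) assoc_mult_mat_vec[OF Zc B(2) s] by simp
  qed
  have main2: "a_hat $ \<tau> \<noteq> 0 \<and> s = subvec S (idx_I N r \<tau>) \<and>
      a = subvec ((- 1 / a_hat $ \<tau>) \<cdot>\<^sub>v a_hat) (idx_K r \<tau>)"
    if s: "s \<in> carrier_vec r" and a: "a \<in> carrier_vec r" and sa: "s @\<^sub>v a \<in> W"
      and S: "S = S\<tau> (s @\<^sub>v a)"
      and ah: "a_hat = (1\<^sub>m (r + 1) - orth_proj (r + 1) (vec_space.col_space (r + 1) (hankel (r + 1) S))) *\<^sub>v a0"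
    for s a S a_hat
  proof -
    let ?a = "insert_minus_one r \<tau> a"
    have S': "subvec S (idx_I N r \<tau>) = s" "glrr N r ?a S" "S \<in> series_rank N r"
      using lp s a sa WU S_rank[OF sa] by (auto simp: local_param_def S)
    have "?a \<bullet> a0 \<noteq> 0" using sa Hsa[OF s a] by (auto simp: W_def)
    then obtain c where c: "c \<noteq> 0" "a_hat = c \<cdot>\<^sub>v ?a"
      using orth_proj_col_space[OF S'(3) r(2) insert_minus_one_carrier S'(2) a0(1)] ah by metis
    have dim_a: "dim_vec ?a = r + 1" by (simp add: insert_minus_one_def)
    \<comment> \<open>The entry of \<open>?a\<close> at \<tau> is -1, so dividing by minus this
      entry of \<open>a_hat\<close> cancels the unknown factor \<open>c\<close>, sign
      included.\<close>
    have "a_hat $ \<tau> = - c" using c r(1) insert_minus_one_index[OF r(1), of a] dim_a by simp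
    moreover have "(1 / c) \<cdot>\<^sub>v a_hat = ?a" using c by (simp add: smult_smult_assoc)
    ultimately show ?thesis using c(1) S'(1) subvec_insert_minus_one[OF a r(1)] by simp
  qed
  show ?thesis
    unfolding Let_def
  proof (intro exI[of _ W] conjI ballI impI allI)
  qed (use W WU main1 main2 in blast)+
qed

end
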